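(* Let $\epsilon>0$ and $\delta>0$ be constants. Every (possibly randomized) cell-probe data structure for the decision version of the $(1+\epsilon)$-approximate nearest neighbor problem for $n$-point sets in the Hamming cube $\{0,1\}^d$ with $d=\Theta(\epsilon^{-2}\log n)$, with query time $t=\Theta(1)$ and word size $w=O(n^{1-\delta})$, uses space $s=n^{\Omega(\epsilon^{-2})}$.
   Context: Decision version of $(1+\epsilon)$-approximate nearest neighbor: the database is a set $P\subseteq\{0,1\}^d$ of $n$ points together with a parameter $L$; a query is a point $\mathbf{q}\in\{0,1\}^d$; the correct answer is ``yes'' if some $\mathbf{p}\in P$ has Hamming distance at most $L$ from $\mathbf{q}$, ``no'' if every $\mathbf{p}\in P$ has Hamming distance at least $(1+\epsilon)L$ from $\mathbf{q}$, and either answer is accepted otherwise. Cell-probe model: a data structure encodes the database into $s$ cells of $w$ bits each (word size $w$, space $s$); a query algorithm answers a query by adaptively reading cells, and its query time $t$ is the maximum number of cells read. A randomized data structure may use random coins and must answer each query correctly with probability at least $2/3$.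
   Formalization: The formal theorem additionally assumes that the n points are at most half of the cube (2n ≤ 2^d), automatic for small ε; without it the claim fails, e.g. for n = 2^d, where the only database is the whole cube and every answer is "yes". *)

theory Defs
  imports "HOL-Probability.Probability"
begin

section \<open>The cell-probe model\<close>

type_synonym cells = "nat \<Rightarrow> bool list"

text \<open>
  An adaptive query algorithm is a decision tree: it either stops with an answer or reads the cell
  with the given address and continues depending on the word found there.
\<close>

datatype probe_alg = Answer bool | Probe nat "bool list \<Rightarrow> probe_alg"

primrec run :: "cells \<Rightarrow> probe_alg \<Rightarrow> bool" where
  "run m (Answer b) = b"
| "run m (Probe i k) = run m (k (m i))"

primrec probes :: "cells \<Rightarrow> probe_alg \<Rightarrow> nat list" where
  "probes m (Answer b) = []"
| "probes m (Probe i k) = i # probes m (k (m i))"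

text \<open>
  A deterministic data structure consists of the encoding of databases and, for each query, the
  query algorithm. The algorithm depends on the database only through the cells it reads.
\<close>

type_synonym ('db, 'q) data_structure = "('db \<Rightarrow> cells) \<times> ('q \<Rightarrow> probe_alg)"

definition answer :: "('db, 'q) data_structure \<Rightarrow> 'db \<Rightarrow> 'q \<Rightarrow> bool" where
  "answer A x q = run (fst A x) (snd A q)"

definition cell_probe ::
  "'db set \<Rightarrow> 'q set \<Rightarrow> nat \<Rightarrow> nat \<Rightarrow> nat \<Rightarrow> ('db, 'q) data_structure \<Rightarrow> bool" where
  "cell_probe X Q s w t A \<longleftrightarrow>
     (\<forall>x\<in>X. (\<forall>i<s. length (fst A x i) = w) \<and>
       (\<forall>q\<in>Q. set (probes (fst A x) (snd A q)) \<subseteq> {..<s} \<and>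
               length (probes (fst A x) (snd A q)) \<le> t))"

text \<open>
  A randomized data structure is a probability distribution on deterministic ones, so the encoding
  and the query algorithm may even share their coins; independent coins are the special case
  of a product distribution, and a deterministic structure is a point mass.
  Space, word size and query time are bounded for every outcome of the coins.
  The relation \<open>ok x q b\<close> says that \<open>b\<close> is an accepted answer to \<open>q\<close> on \<open>x\<close>.
\<close>

definition randomized_cell_probe ::
  "'db set \<Rightarrow> 'q set \<Rightarrow> ('db \<Rightarrow> 'q \<Rightarrow> bool \<Rightarrow> bool) \<Rightarrow> nat \<Rightarrow> nat \<Rightarrow> nat \<Rightarrow>
    ('db, 'q) data_structure pmf \<Rightarrow> bool" where
  "randomized_cell_probe X Q ok s w t D \<longleftrightarrow>
     (\<forall>A\<in>set_pmf D. cell_probe X Q s w t A) \<and>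
     (\<forall>x\<in>X. \<forall>q\<in>Q. measure_pmf.prob D {A. ok x q (answer A x q)} \<ge> 2 / 3)"


section \<open>Approximate nearest neighbors in the Hamming cube\<close>

definition cube :: "nat \<Rightarrow> bool list set" where
  "cube d = {x. length x = d}"

definition hamming :: "bool list \<Rightarrow> bool list \<Rightarrow> nat" where
  "hamming x y = card {i. i < length x \<and> x ! i \<noteq> y ! i}"

text \<open>
  The parameter \<open>L\<close> belongs to the database. It is positive because for \<open>L = 0\<close> a query
  point in \<open>P\<close> would satisfy both the ``yes'' and the ``no'' condition. Only integral \<open>L\<close> occur as
  inputs; a structure that also supports non-integral \<open>L\<close> in particular supports these.
\<close>

definition ann_databases :: "nat \<Rightarrow> nat \<Rightarrow> (bool list set \<times> nat) set" where
  "ann_databases n d = {(P, L). P \<subseteq> cube d \<and> card P = n \<and> L > 0}"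

definition ann_accepted :: "real \<Rightarrow> bool list set \<times> nat \<Rightarrow> bool list \<Rightarrow> bool \<Rightarrow> bool" where
  "ann_accepted \<epsilon> = (\<lambda>(P, L) q b.
     ((\<exists>p\<in>P. hamming p q \<le> L) \<longrightarrow> b) \<and>
     ((\<forall>p\<in>P. real (hamming p q) \<ge> (1 + \<epsilon>) * real L) \<longrightarrow> \<not> b))"

definition ann_data_structure ::
  "real \<Rightarrow> nat \<Rightarrow> nat \<Rightarrow> nat \<Rightarrow> nat \<Rightarrow> nat \<Rightarrow>
    (bool list set \<times> nat, bool list) data_structure pmf \<Rightarrow> bool" where
  "ann_data_structure \<epsilon> n d s w t D \<longleftrightarrow>
     randomized_cell_probe (ann_databases n d) (cube d) (ann_accepted \<epsilon>) s w t D"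

end

theory Submission
  imports Defs "HOL-Real_Asymp.Real_Asymp"
begin

text \<open>
  The hard instances encode lopsided set disjointness. Let \<open>k\<close> be of order \<open>\<epsilon>\<^sup>-\<^sup>2\<close> and \<open>B = n\<close> to a power
  slightly below 1. A query is a tuple \<open>x\<close> in \<open>[B]\<^sup>k\<close>, a database is a set \<open>T\<close> of pairs
  \<open>(i, v)\<close> containing each pair independently with probability \<open>1 - 2 powr (-1/k)\<close>, so that \<open>x\<close> misses
  \<open>T\<close> with probability exactly \<open>1/2\<close>. Give every pair \<open>(i, v)\<close> a uniformly random point of the cube and let
  the query point be the bitwise majority of the \<open>k\<close> points selected by \<open>x\<close>. These \<open>k\<close> points are closer to the
  query than all others by a factor \<open>1 + \<Omega>(1/\<surd>k)\<close>, in dimension \<open>O(k log n)\<close> and for at least half of the tuples.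

  A cell-probe structure partitions the pairs \<open>(x, T)\<close> with answer ``no'' into rectangles, indexed by the
  probed addresses and their contents. If \<open>s\<close> is too small, some rectangle has a set of queries of
  density \<open>B\<close> to the power \<open>-k/10\<close> times a small constant, a set of databases of weight about \<open>2 powr (-t w)\<close>, and few errors. Such a
  set of queries contains many tuples that are pairwise disjoint on nine tenths of the coordinates. For these tuples the
  events of missing \<open>T\<close> are independent, so only an exponentially small weight of databases misses
  nearly two thirds of them. This contradicts the weight of the rectangle, because \<open>t w\<close> is small against
  the number of tuples.
\<close>

section \<open>Rectangles of a cell-probe structure\<close>

text \<open>The query side of a transcript: no memory occurs in it. A label thus splits into a
  condition on the query and a condition on the database, which makes the pairs sharing a label a
  rectangle.\<close>

primrec rejects :: "probe_alg \<Rightarrow> nat list \<Rightarrow> bool list list \<Rightarrow> bool" where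
  "rejects (Answer b) \<alpha> \<beta> \<longleftrightarrow> \<alpha> = [] \<and> \<beta> = [] \<and> \<not> b"
| "rejects (Probe i f) \<alpha> \<beta> \<longleftrightarrow>
     (\<exists>\<alpha>' v \<beta>'. \<alpha> = i # \<alpha>' \<and> \<beta> = v # \<beta>' \<and> rejects (f v) \<alpha>' \<beta>')"

text \<open>Induction on the tree: consistency with the memory forces each word, hence the next
  address. A pair answered "no" therefore lies in exactly one rectangle, and a pair answered "yes"
  in none.\<close>

lemma rejects_run_iff:
  "map m \<alpha> = \<beta> \<and> rejects a \<alpha> \<beta> \<longleftrightarrow> \<not> run m a \<and> \<alpha> = probes m a \<and> \<beta> = map m (probes m a)"
proof (induction a arbitrary: \<alpha> \<beta>)
  case (Probe i f)
  have IH: "rejects (f (m i)) \<alpha>' (map m \<alpha>') \<longleftrightarrow>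
      \<not> run m (f (m i)) \<and> \<alpha>' = probes m (f (m i))" for \<alpha>'
    using Probe[of "f (m i)" \<alpha>' "map m \<alpha>'"] by auto
  show ?case by (cases \<alpha>) (auto simp: IH)
qed auto

section \<open>Counting the labels of rectangles\<close>

definition addresses :: "nat \<Rightarrow> nat \<Rightarrow> nat list set" where
  "addresses s t = {\<alpha>. set \<alpha> \<subseteq> {..<s} \<and> length \<alpha> \<le> t}"

definition contents :: "nat \<Rightarrow> nat \<Rightarrow> bool list list set" where
  "contents w t = {\<beta>. set \<beta> \<subseteq> cube w \<and> length \<beta> \<le> t}"

lemma cube_eq_lists: "cube d = {x. set x \<subseteq> UNIV \<and> length x = d}"
  by (auto simp: cube_def)

lemma finite_cube [simp]: "finite (cube d)"
  unfolding cube_eq_lists by (rule finite_lists_length_eq) simp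

lemma card_cube: "card (cube d) = 2 ^ d"
  unfolding cube_eq_lists by (subst card_lists_length_eq) auto

lemma finite_addresses [simp]: "finite (addresses s t)"
  unfolding addresses_def by (rule finite_lists_length_le) simp

lemma finite_contents [simp]: "finite (contents w t)"
  unfolding contents_def by (rule finite_lists_length_le) simp

text \<open>The base grows to \<open>x + 1\<close> because powers of 0 do not increase with the
  exponent; the bound depends only on the constant \<open>T\<close>, not on the actual number of
  probes.\<close>

lemma sum_powers_le:
  fixes x :: nat
  assumes "t \<le> T"
  shows "(\<Sum>i\<le>t. x ^ i) \<le> (T + 1) * (x + 1) ^ T"
proof -
  have "(\<Sum>i\<le>t. x ^ i) \<le> (\<Sum>i\<le>T. x ^ i)"
    using assms by (intro sum_mono2) auto
  also have "\<dots> \<le> (\<Sum>i\<le>T. (x + 1) ^ T)"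
  proof (intro sum_mono)
    fix i assume "i \<in> {..T}"
    have "x ^ i \<le> (x + 1) ^ i" by (intro power_mono) auto
    also have "\<dots> \<le> (x + 1) ^ T" using \<open>i \<in> {..T}\<close> by (intro power_increasing) auto
    finally show "x ^ i \<le> (x + 1) ^ T" .
  qed
  finally show ?thesis by simp
qed

lemma card_addresses_le: "t \<le> T \<Longrightarrow> card (addresses s t) \<le> (T + 1) * (s + 1) ^ T"
  unfolding addresses_def using sum_powers_le[of t T s] by (subst card_lists_length_le) auto

lemma card_contents_le: 
  assumes "t \<le> T"
  shows "card (contents w t) \<le> (T + 1) * 2 ^ (w * T)"
proof -
  have "card (contents w t) = (\<Sum>i\<le>t. (2 ^ w) ^ i)"
    unfolding contents_def by (subst card_lists_length_le) (auto simp: card_cube)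
  also have "\<dots> \<le> (\<Sum>i\<le>T. (2 ^ w) ^ i)"
    using assms by (intro sum_mono2) auto
  also have "\<dots> \<le> (\<Sum>i\<le>T. (2 ^ w) ^ T)"
    by (intro sum_mono power_increasing) auto
  finally show ?thesis by (simp add: power_mult)
qed

text \<open>
  The label of a rectangle consists of the probed addresses and the words found there, and the database and the
  addresses determine the words. So \<open>N1\<close>, the number of labels compatible with one database, only counts
  addresses; this separates the cost \<open>t log s\<close> on the query side from the much larger \<open>t w\<close> hidden in \<open>N2\<close>.
\<close>

lemma large_rectangle:
  fixes \<mu> :: "'t \<Rightarrow> real" and W :: "'x \<Rightarrow> 't \<Rightarrow> real"
  assumes fin: "finite X" "finite \<Omega>" "finite \<Lambda>" and X: "X \<noteq> {}"
    and \<mu>: "\<And>T. T \<in> \<Omega> \<Longrightarrow> \<mu> T \<ge> 0" "(\<Sum>T\<in>\<Omega>. \<mu> T) = 1"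
    and P: "\<And>x T. x \<in> X \<Longrightarrow> T \<in> \<Omega> \<Longrightarrow> card {l\<in>\<Lambda>. A l x \<and> C l T} = (if P x T then 1 else 0)"
    and N1: "\<And>T. T \<in> \<Omega> \<Longrightarrow> real (card {l\<in>\<Lambda>. C l T}) \<le> N1" "N1 > 0"
    and N2: "real (card \<Lambda>) \<le> N2" "N2 > 0"
    and W: "\<And>x T. W x T \<le> 7"
    and total: "(\<Sum>x\<in>X. \<Sum>T\<in>\<Omega>. \<mu> T * W x T * (if P x T then 1 else 0)) > real (card X) / 7"
  obtains l where "l \<in> \<Lambda>"
    "real (card {x\<in>X. 0 < (\<Sum>T\<in>{T\<in>\<Omega>. C l T}. \<mu> T * W x T)}) > real (card X) / (100 * N1)"
    "(\<Sum>T\<in>{T\<in>\<Omega>. C l T}. \<mu> T) > 1 / (100 * N2)"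
proof (rule ccontr)
  assume neg: "\<not> thesis"
  note rect = that
  define G where "G l = {x\<in>X. 0 < (\<Sum>T\<in>{T\<in>\<Omega>. C l T}. \<mu> T * W x T)}" for l
  define M where "M l = (\<Sum>T\<in>{T\<in>\<Omega>. C l T}. \<mu> T)" for l
  have small: "real (card (G l)) \<le> real (card X) / (100 * N1) \<or> M l \<le> 1 / (100 * N2)"
    if "l \<in> \<Lambda>" for l
    using rect[OF that] neg unfolding G_def M_def by (meson not_less)
  have M0: "M l \<ge> 0" for l
    unfolding M_def using \<mu>(1) by (intro sum_nonneg) auto
  have finG: "finite (G l)" for l using fin by (auto simp: G_def)
  have cX: "card X > 0" using X fin by (simp add: card_gt_0_iff)
  have GX: "card (G l) \<le> card X" for l
    using fin by (intro card_mono) (auto simp: G_def)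
  have "(\<Sum>x\<in>X. \<Sum>T\<in>\<Omega>. \<mu> T * W x T * (if P x T then 1 else 0))
      = (\<Sum>x\<in>X. \<Sum>T\<in>\<Omega>. \<Sum>l\<in>\<Lambda>. if A l x \<and> C l T then \<mu> T * W x T else 0)"
  proof (intro sum.cong refl)
    fix x T assume xT: "x \<in> X" "T \<in> \<Omega>"
    have "(\<Sum>l\<in>\<Lambda>. if A l x \<and> C l T then \<mu> T * W x T else 0) 
        = (\<Sum>l\<in>{l\<in>\<Lambda>. A l x \<and> C l T}. \<mu> T * W x T)"
      using fin by (subst sum.inter_filter) auto
    then show "\<mu> T * W x T * (if P x T then 1 else 0) =
        (\<Sum>l\<in>\<Lambda>. if A l x \<and> C l T then \<mu> T * W x T else 0)"
      using P[OF xT] by auto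
  qed
  also have "\<dots> = (\<Sum>l\<in>\<Lambda>. \<Sum>x\<in>X. \<Sum>T\<in>\<Omega>. if A l x \<and> C l T then \<mu> T * W x T else 0)"
    by (subst sum.swap[of _ \<Lambda> \<Omega>], subst sum.swap[of _ \<Lambda> X], rule refl)
  \<comment> \<open>Rows of non-positive weight are dropped; every other row of the rectangle
    contributes at most 7 times its database mass.\<close>
  also have "\<dots> \<le> (\<Sum>l\<in>\<Lambda>. 7 * real (card (G l)) * M l)"
  proof (intro sum_mono)
    fix l assume "l \<in> \<Lambda>"
    have "(\<Sum>x\<in>X. \<Sum>T\<in>\<Omega>. if A l x \<and> C l T then \<mu> T * W x T else 0)
        \<le> (\<Sum>x\<in>X. if x \<in> G l then 7 * M l else 0)"
    proof (intro sum_mono)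
      fix x assume x: "x \<in> X"
      have *: "(\<Sum>T\<in>\<Omega>. if C l T then \<mu> T * W x T else 0) = (\<Sum>T\<in>{T\<in>\<Omega>. C l T}. \<mu> T * W x T)"
        using fin by (subst sum.inter_filter) auto
      have "(\<Sum>T\<in>{T\<in>\<Omega>. C l T}. \<mu> T * W x T) \<le> (\<Sum>T\<in>{T\<in>\<Omega>. C l T}. \<mu> T * 7)"
        using \<mu>(1) W by (intro sum_mono mult_left_mono) auto
      also have "\<dots> = 7 * M l" by (simp add: M_def sum_distrib_left mult.commute)
      finally show "(\<Sum>T\<in>\<Omega>. if A l x \<and> C l T then \<mu> T * W x T else 0)
          \<le> (if x \<in> G l then 7 * M l else 0)"
        using * x M0[of l] by (cases "A l x") (auto simp: G_def)
    qed
    also have "\<dots> = (\<Sum>x\<in>G l. 7 * M l)"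
      using fin by (subst sum.inter_filter[symmetric]) (auto simp: G_def intro!: sum.cong)
    finally show "(\<Sum>x\<in>X. \<Sum>T\<in>\<Omega>. if A l x \<and> C l T then \<mu> T * W x T else 0)
        \<le> 7 * real (card (G l)) * M l" by (simp add: mult_ac)
  qed
  \<comment> \<open>A label with few rows is charged in proportion to its mass, a label with little
    mass a fixed amount. Each kind costs at most 7/100 of \<open>card X\<close> in total, and 14/100
    is below 1/7.\<close>
  also have "\<dots> \<le> (\<Sum>l\<in>\<Lambda>. 7 * real (card X) / (100 * N1) * M l + 7 * real (card X) / (100 * N2))"
  proof (intro sum_mono)
    fix l assume l: "l \<in> \<Lambda>"
    have p: "7 * real (card X) / (100 * N1) * M l \<ge> 0" "7 * real (card X) / (100 * N2) \<ge> 0"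
      using N1(2) N2(2) M0 by auto
    from small[OF l] show "7 * real (card (G l)) * M l
        \<le> 7 * real (card X) / (100 * N1) * M l + 7 * real (card X) / (100 * N2)"
    proof
      assume "real (card (G l)) \<le> real (card X) / (100 * N1)"
      from mult_right_mono[OF this, of "7 * M l"] M0[of l] p(2) show ?thesis by (simp add: algebra_simps)
    next
      assume "M l \<le> 1 / (100 * N2)"
      with GX[of l] M0[of l] have "real (card (G l)) * M l \<le> real (card X) * (1 / (100 * N2))"
        by (intro mult_mono) auto
      with p(1) show ?thesis by (simp add: algebra_simps)
    qed
  qed
  also have "\<dots> = 7 * real (card X) / (100 * N1) * (\<Sum>l\<in>\<Lambda>. M l)
      + real (card \<Lambda>) * (7 * real (card X) / (100 * N2))"
    by (simp add: sum.distrib sum_distrib_left)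
  \<comment> \<open>Double counting: a database is counted once for each label compatible with it,
    so at most \<open>N1\<close> times.\<close>
  also have "(\<Sum>l\<in>\<Lambda>. M l) = (\<Sum>l\<in>\<Lambda>. \<Sum>T\<in>\<Omega>. if C l T then \<mu> T else 0)"
    unfolding M_def using fin by (intro sum.cong[OF refl]) (simp add: sum.inter_filter)
  also have "\<dots> = (\<Sum>T\<in>\<Omega>. \<Sum>l\<in>\<Lambda>. if C l T then \<mu> T else 0)" by (rule sum.swap)
  also have "\<dots> = (\<Sum>T\<in>\<Omega>. real (card {l\<in>\<Lambda>. C l T}) * \<mu> T)"
    using fin by (intro sum.cong refl) (subst sum.inter_filter[symmetric], auto)
  also have "7 * real (card X) / (100 * N1) * (\<Sum>T\<in>\<Omega>. real (card {l\<in>\<Lambda>. C l T}) * \<mu> T)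
      + real (card \<Lambda>) * (7 * real (card X) / (100 * N2))
      \<le> 7 * real (card X) / (100 * N1) * (\<Sum>T\<in>\<Omega>. N1 * \<mu> T) + N2 * (7 * real (card X) / (100 * N2))"
    using N1 N2 \<mu>(1) by (intro add_mono mult_left_mono mult_right_mono sum_mono) auto
  also have "\<dots> = 14 / 100 * real (card X)"
    using N1(2) N2(2) by (simp add: sum_distrib_left[symmetric] \<mu>(2))
  finally show False using total cX by simp
qed

section \<open>Random sets and dense sets of tuples\<close>

text \<open>The law of a random subset of \<open>U\<close> with independent membership. The
  parameter \<rho> is the probability of absence, since avoidance is the event of interest.\<close>

definition product_weight :: "real \<Rightarrow> 'a set \<Rightarrow> 'a set \<Rightarrow> real" where
  "product_weight \<rho> U T = (1 - \<rho>) ^ card T * \<rho> ^ card (U - T)"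

lemma product_weight_nonneg: "0 \<le> \<rho> \<Longrightarrow> \<rho> \<le> 1 \<Longrightarrow> 0 \<le> product_weight \<rho> U T"
  by (simp add: product_weight_def)

text \<open>Once the absence of \<open>V\<close> is factored out, the remaining sum is the expansion
  of a product of factors (1 - \<rho>) + \<rho> over \<open>U - V\<close>.\<close>

lemma sum_product_weight_avoiding:
  assumes "finite U" "V \<subseteq> U"
  shows "(\<Sum>T\<in>{T\<in>Pow U. T \<inter> V = {}}. product_weight \<rho> U T) = \<rho> ^ card V"
proof -
  have fV: "finite V" "finite (U - V)" using assms finite_subset by auto
  have "(\<Sum>T\<in>{T\<in>Pow U. T \<inter> V = {}}. product_weight \<rho> U T)
      = (\<Sum>T\<in>Pow (U - V). \<rho> ^ card V * ((\<Prod>x\<in>T. 1 - \<rho>) * (\<Prod>x\<in>(U - V) - T. \<rho>)))"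
  proof (rule sum.cong)
    fix T assume T: "T \<in> Pow (U - V)"
    have "card (U - T) = card (V \<union> ((U - V) - T))"
      using assms T by (intro arg_cong[of _ _ card]) auto
    also have "\<dots> = card V + card ((U - V) - T)"
      using fV T by (intro card_Un_disjoint) auto
    finally show "product_weight \<rho> U T = \<rho> ^ card V * ((\<Prod>x\<in>T. 1 - \<rho>) * (\<Prod>x\<in>(U - V) - T. \<rho>))"
      by (simp add: product_weight_def power_add)
  qed (use assms in auto)
  also have "\<dots> = \<rho> ^ card V * (\<Prod>x\<in>U - V. (1 - \<rho>) + \<rho>)"
    using fV by (subst prod_add) (auto simp: sum_distrib_left)
  finally show ?thesis by simp
qed

corollary sum_product_weight:
  "finite U \<Longrightarrow> (\<Sum>T\<in>Pow U. product_weight \<rho> U T) = 1"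
  using sum_product_weight_avoiding[of U "{}" \<rho>] by (simp add: Pow_def)

text \<open>
  Expanding \<open>2 ^ N\<close> over subfamilies turns the joint independence of the events \<open>T \<inter> V x = {}\<close> into
  the additivity of cardinality on disjoint sets.
\<close>

lemma sum_product_weight_exponential:
  assumes U: "finite U" and F: "finite F" and V: "\<And>x. x \<in> F \<Longrightarrow> V x \<subseteq> U"
    and disj: "disjoint_family_on V F" and c: "\<And>x. x \<in> F \<Longrightarrow> card (V x) = c"
  shows "(\<Sum>T\<in>Pow U. product_weight \<rho> U T * 2 ^ card {x\<in>F. T \<inter> V x = {}}) = (1 + \<rho> ^ c) ^ card F"
proof -
  have "(\<Sum>T\<in>Pow U. product_weight \<rho> U T * 2 ^ card {x\<in>F. T \<inter> V x = {}})
      = (\<Sum>T\<in>Pow U. \<Sum>S\<in>Pow F. if T \<inter> (\<Union>x\<in>S. V x) = {} then product_weight \<rho> U T else 0)"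
  proof (intro sum.cong refl)
    fix T
    have "(\<Sum>S\<in>Pow F. if T \<inter> (\<Union>x\<in>S. V x) = {} then product_weight \<rho> U T else 0)
        = (\<Sum>S\<in>Pow {x\<in>F. T \<inter> V x = {}}. product_weight \<rho> U T)"
      using F by (subst sum.inter_filter[symmetric], simp, intro sum.cong) auto
    also have "\<dots> = product_weight \<rho> U T * 2 ^ card {x\<in>F. T \<inter> V x = {}}"
      using F by (simp add: card_Pow)
    finally show "product_weight \<rho> U T * 2 ^ card {x\<in>F. T \<inter> V x = {}} =
      (\<Sum>S\<in>Pow F. if T \<inter> (\<Union>x\<in>S. V x) = {} then product_weight \<rho> U T else 0)" ..
  qed
  also have "\<dots> = (\<Sum>S\<in>Pow F. \<Sum>T\<in>Pow U. if T \<inter> (\<Union>x\<in>S. V x) = {} then product_weight \<rho> U T else 0)"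
    by (rule sum.swap)
  also have "\<dots> = (\<Sum>S\<in>Pow F. (\<Prod>x\<in>S. \<rho> ^ c) * (\<Prod>x\<in>F - S. 1))"
  proof (intro sum.cong refl)
    fix S assume S: "S \<in> Pow F"
    have fS: "finite S" using S F finite_subset by auto
    have "(\<Sum>T\<in>Pow U. if T \<inter> (\<Union>x\<in>S. V x) = {} then product_weight \<rho> U T else 0)
        = \<rho> ^ card (\<Union>x\<in>S. V x)"
      using U V S by (subst sum.inter_filter[symmetric], simp, intro sum_product_weight_avoiding) auto
    also have "card (\<Union>x\<in>S. V x) = (\<Sum>x\<in>S. card (V x))"
    proof (rule card_UN_disjoint[OF fS])
      show "\<forall>x\<in>S. finite (V x)" using S V U finite_subset by blast
      show "\<forall>x\<in>S. \<forall>y\<in>S. x \<noteq> y \<longrightarrow> V x \<inter> V y = {}"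
        using S disj unfolding disjoint_family_on_def by blast
    qed
    also have "\<dots> = c * card S" using S c by (simp add: subset_iff)
    finally show "(\<Sum>T\<in>Pow U. if T \<inter> (\<Union>x\<in>S. V x) = {} then product_weight \<rho> U T else 0)
        = (\<Prod>x\<in>S. \<rho> ^ c) * (\<Prod>x\<in>F - S. 1)" by (simp add: power_mult)
  qed
  also have "\<dots> = (\<Prod>x\<in>F. \<rho> ^ c + 1)" by (rule prod_add[OF F, symmetric])
  finally show ?thesis by (simp add: add.commute)
qed

text \<open>Convexity in tangent form; it takes the place of Jensen's inequality for a measure that
  is not normalized.\<close>

lemma two_powr_tangent:
  "2 powr x \<ge> 2 powr a * (1 + ln 2 * (x - a))" for x a :: real
proof -
  have "2 powr x = 2 powr a * exp (ln 2 * (x - a))"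
    by (simp add: powr_def algebra_simps flip: exp_add)
  then show ?thesis using exp_ge_add_one_self[of "ln 2 * (x - a)"] by (simp add: mult_left_mono)
qed

text \<open>Exponential moments. On \<T> the number of avoided sets averages at least
  \<open>\<kappa> * card F\<close>, so by convexity 2 to that number averages at least
  \<open>2 powr (\<kappa> * card F)\<close>. Its total over all of \<open>Pow U\<close> is
  \<open>(1 + \<rho> ^ c) ^ card F\<close> by independence.\<close>

lemma weight_of_often_avoiding_family:
  assumes U: "finite U" and F: "finite F" and V: "\<And>x. x \<in> F \<Longrightarrow> V x \<subseteq> U"
    and disj: "disjoint_family_on V F" and c: "\<And>x. x \<in> F \<Longrightarrow> card (V x) = c"
    and \<rho>: "0 \<le> \<rho>" "\<rho> \<le> 1" and TT: "\<T> \<subseteq> Pow U"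
    and avoid: "\<And>x. x \<in> F \<Longrightarrow> (\<Sum>T\<in>{T\<in>\<T>. T \<inter> V x = {}}. product_weight \<rho> U T)
       \<ge> \<kappa> * (\<Sum>T\<in>\<T>. product_weight \<rho> U T)"
  shows "(\<Sum>T\<in>\<T>. product_weight \<rho> U T) \<le> ((1 + \<rho> ^ c) / 2 powr \<kappa>) ^ card F"
proof -
  let ?\<mu> = "product_weight \<rho> U" and ?N = "\<lambda>T. card {x\<in>F. T \<inter> V x = {}}" and ?m = "real (card F)"
  have fT: "finite \<T>" using TT U by (meson finite_Pow_iff finite_subset)
  have "\<kappa> * ?m * (\<Sum>T\<in>\<T>. ?\<mu> T) = (\<Sum>x\<in>F. \<kappa> * (\<Sum>T\<in>\<T>. ?\<mu> T))" by simp
  also have "\<dots> \<le> (\<Sum>x\<in>F. \<Sum>T\<in>\<T>. if T \<inter> V x = {} then ?\<mu> T else 0)"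
    using avoid fT by (intro sum_mono) (simp flip: sum.inter_filter)
  also have "\<dots> = (\<Sum>T\<in>\<T>. \<Sum>x\<in>F. if T \<inter> V x = {} then ?\<mu> T else 0)" by (rule sum.swap)
  also have "\<dots> = (\<Sum>T\<in>\<T>. ?\<mu> T * ?N T)"
    using F by (intro sum.cong refl) (simp flip: sum.inter_filter)
  finally have mean: "0 \<le> (\<Sum>T\<in>\<T>. ?\<mu> T * (real (?N T) - \<kappa> * ?m))"
    by (simp add: right_diff_distrib sum_subtractf sum_distrib_left[symmetric] sum_distrib_right[symmetric] mult_ac)
  have "2 powr (\<kappa> * ?m) * (\<Sum>T\<in>\<T>. ?\<mu> T) 
      \<le> 2 powr (\<kappa> * ?m) * ((\<Sum>T\<in>\<T>. ?\<mu> T) + ln 2 * (\<Sum>T\<in>\<T>. ?\<mu> T * (real (?N T) - \<kappa> * ?m)))"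
    using mean by (intro mult_left_mono) auto
  also have "\<dots> = (\<Sum>T\<in>\<T>. ?\<mu> T * (2 powr (\<kappa> * ?m) * (1 + ln 2 * (real (?N T) - \<kappa> * ?m))))"
    by (simp add: sum_distrib_left sum.distrib[symmetric] algebra_simps)
  also have "\<dots> \<le> (\<Sum>T\<in>\<T>. ?\<mu> T * 2 powr real (?N T))"
    using \<rho> by (intro sum_mono mult_left_mono two_powr_tangent product_weight_nonneg)
  also have "\<dots> \<le> (\<Sum>T\<in>Pow U. ?\<mu> T * 2 powr real (?N T))"
    using U TT \<rho> by (intro sum_mono2) (auto intro!: mult_nonneg_nonneg product_weight_nonneg)
  also have "\<dots> = (1 + \<rho> ^ c) ^ card F"
    using sum_product_weight_exponential[OF U F V disj c, of \<rho>] by (simp add: powr_realpow)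
  finally have "(\<Sum>T\<in>\<T>. ?\<mu> T) \<le> (1 + \<rho> ^ c) ^ card F / 2 powr (\<kappa> * ?m)"
    by (simp add: field_simps)
  also have "2 powr (\<kappa> * ?m) = (2 powr \<kappa>) ^ card F"
    by (simp add: powr_powr flip: powr_realpow)
  finally show ?thesis by (simp add: power_divide)
qed

section \<open>Dense sets of tuples and nearly disjoint subfamilies\<close>

abbreviation tuples :: "nat \<Rightarrow> nat \<Rightarrow> (nat \<Rightarrow> nat) set" where
  "tuples k B \<equiv> {..<k} \<rightarrow>\<^sub>E {..<B}"

lemma finite_tuples: "finite (tuples k B)"
  by (intro finite_PiE) auto

lemma card_tuples: "card (tuples k B) = B ^ k"
  by (simp add: card_PiE)

lemma card_tuples_fixed:
  assumes "J \<subseteq> {..<k}"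
  shows "card {x\<in>tuples k B. \<forall>i\<in>J. x i = y i} \<le> B ^ (k - card J)"
proof -
  have fin: "finite J" using assms finite_subset by auto
  have "inj_on (\<lambda>x. restrict x ({..<k} - J)) {x\<in>tuples k B. \<forall>i\<in>J. x i = y i}"
  proof (intro inj_onI)
    fix x x' assume *: "x \<in> {x\<in>tuples k B. \<forall>i\<in>J. x i = y i}" "x' \<in> {x\<in>tuples k B. \<forall>i\<in>J. x i = y i}"
      "restrict x ({..<k} - J) = restrict x' ({..<k} - J)"
    show "x = x'"
    proof (rule PiE_ext[of x "{..<k}" "\<lambda>_. {..<B}"])
      fix i assume "i \<in> {..<k}"
      then show "x i = x' i" using * by (cases "i \<in> J") (auto dest: fun_cong[of _ _ i])
    qed (use * in auto)
  qed
  then have "card {x\<in>tuples k B. \<forall>i\<in>J. x i = y i} \<le> card (({..<k} - J) \<rightarrow>\<^sub>E {..<B})"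
    by (rule card_inj_on_le) (auto intro!: finite_PiE)
  also have "\<dots> = B ^ (k - card J)"
    using assms fin by (simp add: card_PiE card_Diff_subset)
  finally show ?thesis .
qed

text \<open>
  Coordinates are fixed as long as some value is taken by more than a \<open>1/M\<close> fraction of the remaining
  tuples. Each step raises the density by a factor \<open>B/M\<close>, so a dense set stops early.
\<close>

lemma fix_heavy_coordinates:
  assumes X: "X \<subseteq> tuples k B" "X \<noteq> {}" and M: "M > 0"
  obtains J X' where "J \<subseteq> {..<k}" "X' \<subseteq> X" "X' \<noteq> {}"
    "real (card X) * real B ^ card J \<le> real B ^ k * real M ^ card J"
    "\<And>i v. i \<in> {..<k} - J \<Longrightarrow> card {x\<in>X'. x i = v} * M \<le> card X'"
proof -
  define S where "S J y = {x\<in>X. \<forall>i\<in>J. x i = y i}" for J and y :: "nat \<Rightarrow> nat"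
  define Q where "Q J \<longleftrightarrow> J \<subseteq> {..<k} \<and> (\<exists>y. card X \<le> card (S J y) * M ^ card J)" for J
  have finX: "finite X" using X finite_subset[OF _ finite_tuples] by auto
  have cX: "card X > 0" using finX X by (simp add: card_gt_0_iff)
  have "Q {}" by (auto simp: Q_def S_def)
  moreover have "\<forall>J. Q J \<longrightarrow> card J < Suc k"
    by (auto simp: Q_def less_Suc_eq_le dest: card_mono[rotated])
  \<comment> \<open>A set \<open>J\<close> of largest size replaces the iteration: a heavy value at
    another coordinate could be fixed too and would contradict maximality.\<close>
  ultimately obtain J where J: "Q J" "\<And>J'. Q J' \<Longrightarrow> card J' \<le> card J"
    using ex_has_greatest_nat[of Q "{}" card "Suc k"] by (metis less_imp_le)
  then obtain y where Jk: "J \<subseteq> {..<k}" and y: "card X \<le> card (S J y) * M ^ card J"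
    by (auto simp: Q_def)
  have finJ: "finite J" using Jk finite_subset by auto
  have "card (S J y) > 0" using y cX by (cases "card (S J y)") auto
  show thesis
  proof (rule that[of J "S J y"])
    show "S J y \<noteq> {}" using \<open>card (S J y) > 0\<close> by auto
    have "card (S J y) \<le> card {x\<in>tuples k B. \<forall>i\<in>J. x i = y i}"
      using X finite_tuples[of k B] by (intro card_mono) (auto simp: S_def)
    also have "\<dots> \<le> B ^ (k - card J)" by (rule card_tuples_fixed[OF Jk])
    finally have "card X * B ^ card J \<le> B ^ (k - card J) * M ^ card J * B ^ card J"
      using y by (meson mult_le_mono1 le_trans)
    also have "\<dots> = (B ^ (k - card J) * B ^ card J) * M ^ card J" by (simp add: mult_ac)
    also have "B ^ (k - card J) * B ^ card J = B ^ k"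
      using card_mono[OF _ Jk] by (simp flip: power_add)
    finally show "real (card X) * real B ^ card J \<le> real B ^ k * real M ^ card J"
      by (metis of_nat_le_iff of_nat_mult of_nat_power)
    fix i v assume i: "i \<in> {..<k} - J"
    show "card {x\<in>S J y. x i = v} * M \<le> card (S J y)"
    proof (rule ccontr)
      assume "\<not> ?thesis"
      then have *: "card (S J y) \<le> card {x\<in>S J y. x i = v} * M" by simp
      have "{x\<in>S J y. x i = v} = S (insert i J) (y(i := v))"
        using i by (auto simp: S_def)
      with * have "card (S J y) * M ^ card J \<le> card (S (insert i J) (y(i := v))) * M ^ card (insert i J)"
        using finJ i by (simp add: mult_ac)
      with y have "Q (insert i J)" using i Jk by (auto simp: Q_def intro: le_trans)
      from J(2)[OF this] show False using finJ i by simp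
    qed
  qed (use Jk in \<open>auto simp: S_def\<close>)
qed

text \<open>Greedy choice. The tuples agreeing somewhere on \<open>I\<close> with one of
  \<open>j < m\<close> chosen tuples form a set \<open>Bl\<close> covered by
  \<open>j * card I\<close> value classes, each of at most a 1/(k m) fraction, so some tuple is
  left.\<close>

lemma disjoint_subfamily:
  assumes fin: "finite X'" and ne: "X' \<noteq> {}" and I: "finite I" "I \<noteq> {}" "card I \<le> k"
    and light: "\<And>i v. i \<in> I \<Longrightarrow> card {x\<in>X'. x i = v} * (k * m) \<le> card X'"
  obtains F where "F \<subseteq> X'" "card F = m" "\<And>x x' i. x \<in> F \<Longrightarrow> x' \<in> F \<Longrightarrow> x \<noteq> x' \<Longrightarrow> i \<in> I \<Longrightarrow> x i \<noteq> x' i"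
proof -
  have "\<exists>F\<subseteq>X'. card F = j \<and> (\<forall>x\<in>F. \<forall>x'\<in>F. x \<noteq> x' \<longrightarrow> (\<forall>i\<in>I. x i \<noteq> x' i))" if "j \<le> m" for j
    using that
  proof (induction j)
    case (Suc j)
    then obtain F where F: "F \<subseteq> X'" "card F = j" and
      sep: "\<forall>x\<in>F. \<forall>x'\<in>F. x \<noteq> x' \<longrightarrow> (\<forall>i\<in>I. x i \<noteq> x' i)" by auto
    have finF: "finite F" using F fin finite_subset by blast
    define Bl where "Bl = (\<Union>x\<in>F. \<Union>i\<in>I. {x'\<in>X'. x' i = x i})"
    have "card Bl \<le> (\<Sum>x\<in>F. card (\<Union>i\<in>I. {x'\<in>X'. x' i = x i}))"
      unfolding Bl_def by (rule card_UN_le[OF finF])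
    also have "\<dots> \<le> (\<Sum>x\<in>F. \<Sum>i\<in>I. card {x'\<in>X'. x' i = x i})"
      by (intro sum_mono card_UN_le I)
    finally have "card Bl * (k * m) \<le> (\<Sum>x\<in>F. \<Sum>i\<in>I. card {x'\<in>X'. x' i = x i}) * (k * m)"
      by (rule mult_le_mono1)
    also have "\<dots> = (\<Sum>x\<in>F. \<Sum>i\<in>I. card {x'\<in>X'. x' i = x i} * (k * m))"
      by (simp add: sum_distrib_right)
    also have "\<dots> \<le> (\<Sum>x\<in>F. \<Sum>i\<in>I. card X')"
      by (intro sum_mono light)
    also have "\<dots> = (j * card I) * card X'" using F by simp
    also have "\<dots> < (k * m) * card X'"
    proof -
      have "card I > 0" using I by (simp add: card_gt_0_iff)
      then have "j * card I < m * k" using Suc.prems I(3) by (intro mult_less_le_imp_less) auto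
      moreover have "card X' > 0" using fin ne by (simp add: card_gt_0_iff)
      ultimately show ?thesis by (simp add: mult.commute)
    qed
    finally have "card Bl < card X'" by (simp add: mult.commute)
    then have "\<not> X' \<subseteq> Bl"
      using card_mono[of Bl X'] fin finF I(1) by (auto simp: Bl_def)
    then obtain x where x: "x \<in> X'" "x \<notin> Bl" by blast
    have new: "\<forall>x'\<in>F. \<forall>i\<in>I. x i \<noteq> x' i" using x by (auto simp: Bl_def)
    \<comment> \<open>A member of \<open>F\<close> agrees with itself on the nonempty set
      \<open>I\<close>, so the tuple found is new and the family really grows.\<close>
    with I(2) have "x \<notin> F" by blast
    show ?case
    proof (intro exI[of _ "insert x F"] conjI)
      show "\<forall>y\<in>insert x F. \<forall>y'\<in>insert x F. y \<noteq> y' \<longrightarrow> (\<forall>i\<in>I. y i \<noteq> y' i)"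
        using new sep by (metis insert_iff)
    qed (use F x \<open>x \<notin> F\<close> finF in auto)
  qed (auto intro!: exI[of _ "{}"])
  from this[of m] that show thesis by blast
qed

section \<open>Lopsided set disjointness\<close>

text \<open>A quantitative gap between 13/20, the fraction of databases missed, and log 2 (1 + 2
  powr (-9/10)), where 9/10 is the share of coordinates left free. Tenth and twentieth powers reduce
  it to rational arithmetic.\<close>

lemma avoidance_constant: "(1 + 2 powr (-9/10)) / 2 powr (13/20) \<le> (99/100 :: real)"
proof -
  have a: "(2::real) powr (1/10) \<le> 1072/1000"
  proof (rule power_le_imp_le_base[of _ 9])
    have "((2::real) powr (1/10)) ^ Suc 9 = 2" by (simp add: powr_powr flip: powr_realpow)
    then show "((2::real) powr (1/10)) ^ Suc 9 \<le> (1072/1000) ^ Suc 9"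
      by (simp add: power_divide)
  qed simp
  have "(2::real) powr (-9/10) = 2 powr (1/10) / 2"
    using powr_diff[of 2 "1/10" "1 :: real"] by simp
  with a have b: "1 + (2::real) powr (-9/10) \<le> 1536/1000" by simp
  have c: "(1565/1000 :: real) \<le> 2 powr (13/20)"
  proof (rule power_le_imp_le_base[of _ 19])
    have "((2::real) powr (13/20)) ^ Suc 19 = 2 powr 13" by (simp add: powr_powr flip: powr_realpow)
    also have "\<dots> = 2 ^ 13" by (subst powr_numeral) auto
    finally show "(1565/1000 :: real) ^ Suc 19 \<le> (2 powr (13/20)) ^ Suc 19"
      by (simp add: power_divide)
  qed simp
  have "(1 + 2 powr (-9/10)) / 2 powr (13/20) \<le> (1536/1000) / (1565/1000 :: real)"
    using b c by (intro frac_le) auto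
  also have "\<dots> \<le> 99/100" by simp
  finally show ?thesis .
qed

text \<open>The averaging step that fixes the coins. The coefficients may have either sign, so
  rewards for right answers and penalties for wrong ones are treated at once.\<close>

lemma exists_outcome_above_expectation:
  fixes D :: "'a pmf" and c :: "'x \<Rightarrow> 't \<Rightarrow> real" and E :: "'x \<Rightarrow> 't \<Rightarrow> 'a set"
  assumes "b < (\<Sum>x\<in>X. \<Sum>T\<in>\<Omega>. c x T * measure_pmf.prob D (E x T))"
  obtains A where "A \<in> set_pmf D" "b < (\<Sum>x\<in>X. \<Sum>T\<in>\<Omega>. c x T * indicator (E x T) A)"
proof (rule ccontr)
  assume neg: "\<not> thesis"
  note above = that
  have *: "(\<Sum>x\<in>X. \<Sum>T\<in>\<Omega>. c x T * indicator (E x T) A) \<le> b" if "A \<in> set_pmf D" for A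
    using above[OF that] neg by (meson not_less)
  have int1: "integrable (measure_pmf D) (\<lambda>A. c x T * indicator (E x T) A)" for x T
    by (intro integrable_mult_right measure_pmf.integrable_const_bound[of _ 1]) auto
  have int: "integrable (measure_pmf D) (\<lambda>A. \<Sum>x\<in>X. \<Sum>T\<in>\<Omega>. c x T * indicator (E x T) A)"
    by (intro Bochner_Integration.integrable_sum int1)
  have "(\<Sum>x\<in>X. \<Sum>T\<in>\<Omega>. c x T * measure_pmf.prob D (E x T))
      = (\<Sum>x\<in>X. \<Sum>T\<in>\<Omega>. measure_pmf.expectation D (\<lambda>A. c x T * indicator (E x T) A))"
    by simp
  also have "\<dots> = (\<Sum>x\<in>X. measure_pmf.expectation D (\<lambda>A. \<Sum>T\<in>\<Omega>. c x T * indicator (E x T) A))"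
    by (intro sum.cong refl Bochner_Integration.integral_sum[symmetric] int1)
  also have "\<dots> = measure_pmf.expectation D (\<lambda>A. \<Sum>x\<in>X. \<Sum>T\<in>\<Omega>. c x T * indicator (E x T) A)"
    by (intro Bochner_Integration.integral_sum[symmetric] Bochner_Integration.integrable_sum int1)
  also have "\<dots> \<le> b"
    using int * by (intro measure_pmf.integral_le_const) (auto simp: AE_measure_pmf_iff)
  finally show False using assms by simp
qed

text \<open>
  With weight 7 for missing and -13 for hitting pairs, error probability 1/3 leaves the answers ``no'' a positive
  total weight \<open>(7 * 2/3 - 13 * 1/3) / 2\<close>, while positive weight of a row means a missing fraction above 13/20.
  Since 13/20 exceeds \<open>log 2 (1 + 2 powr (-9/10))\<close>, no amplification is needed.
\<close>

lemma hard_rectangle: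
  fixes D :: "('db, 'q) data_structure pmf" and db :: "(nat \<times> nat) set \<Rightarrow> 'db" 
    and qu :: "(nat \<Rightarrow> nat) \<Rightarrow> 'q" and hit :: "(nat \<Rightarrow> nat) \<Rightarrow> (nat \<times> nat) set \<Rightarrow> bool"
    and \<mu> :: "(nat \<times> nat) set \<Rightarrow> real"
  assumes fin: "finite X" "finite \<Omega>" and X: "X \<noteq> {}"
    and \<mu>: "\<And>T. T \<in> \<Omega> \<Longrightarrow> \<mu> T \<ge> 0" "(\<Sum>T\<in>\<Omega>. \<mu> T) = 1"
    and half: "\<And>x. x \<in> X \<Longrightarrow> (\<Sum>T\<in>{T\<in>\<Omega>. \<not> hit x T}. \<mu> T) = 1 / 2"
    and D: "randomized_cell_probe DB Q ok s w t D"
    and db: "\<And>T. T \<in> \<Omega> \<Longrightarrow> db T \<in> DB" and qu: "\<And>x. x \<in> X \<Longrightarrow> qu x \<in> Q"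
    and ok: "\<And>x T b. x \<in> X \<Longrightarrow> T \<in> \<Omega> \<Longrightarrow> ok (db T) (qu x) b \<Longrightarrow> b \<longleftrightarrow> hit x T"
    and t: "t \<le> t0" and N1: "N1 = real ((t0 + 1) * (s + 1) ^ t0)"
    and N2: "N2 = N1 * real ((t0 + 1) * 2 ^ (w * t0))"
  obtains \<T> where "\<T> \<subseteq> \<Omega>" "(\<Sum>T\<in>\<T>. \<mu> T) > 1 / (100 * N2)"
    "real (card {x\<in>X. (\<Sum>T\<in>{T\<in>\<T>. \<not> hit x T}. \<mu> T) \<ge> 13 / 20 * (\<Sum>T\<in>\<T>. \<mu> T)})
       > real (card X) / (100 * N1)"
proof -
  define W :: "(nat \<Rightarrow> nat) \<Rightarrow> (nat \<times> nat) set \<Rightarrow> real"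
    where "W x T = (if hit x T then -13 else 7)" for x T
  have cX: "card X > 0" using X fin by (simp add: card_gt_0_iff)
  have total: "real (card X) / 7 
      < (\<Sum>x\<in>X. \<Sum>T\<in>\<Omega>. \<mu> T * W x T * measure_pmf.prob D {A. \<not> answer A (db T) (qu x)})"
  proof -
    have "real (card X) / 7 < (\<Sum>x\<in>X. 1 / 6)" using cX by simp
    \<comment> \<open>A "no" has probability at least 2/3 on missing pairs and at most 1/3 on
      hitting ones, so the expected weight is at least 14/3 = 9 - 13/3 or -13/3. With half of the
      weight missing, a row gets 9/2 - 13/3 = 1/6.\<close>
    also have "\<dots> \<le> (\<Sum>x\<in>X. \<Sum>T\<in>\<Omega>. \<mu> T * (if \<not> hit x T then 9 else 0) - \<mu> T * (13 / 3))"
    proof (intro sum_mono)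
      fix x assume x: "x \<in> X"
      have "(\<Sum>T\<in>\<Omega>. \<mu> T * (if \<not> hit x T then 9 else 0)) = 9 * (\<Sum>T\<in>{T\<in>\<Omega>. \<not> hit x T}. \<mu> T)"
        using fin by (simp add: sum.inter_filter sum_distrib_left if_distrib mult.commute cong: if_cong)
      also have "\<dots> = 9 / 2" by (simp add: half[OF x])
      finally show "1 / 6 \<le> (\<Sum>T\<in>\<Omega>. \<mu> T * (if \<not> hit x T then 9 else 0) - \<mu> T * (13 / 3))"
        using \<mu>(2) by (simp add: sum_subtractf flip: sum_divide_distrib sum_distrib_right)
    qed
    also have "\<dots> \<le> (\<Sum>x\<in>X. \<Sum>T\<in>\<Omega>. \<mu> T * W x T * measure_pmf.prob D {A. \<not> answer A (db T) (qu x)})"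
    proof (intro sum_mono)
      fix x T assume x: "x \<in> X" and T: "T \<in> \<Omega>"
      let ?p = "measure_pmf.prob D {A. \<not> answer A (db T) (qu x)}"
      have P: "2 / 3 \<le> measure_pmf.prob D {A. ok (db T) (qu x) (answer A (db T) (qu x))}"
        using D db[OF T] qu[OF x] by (auto simp: randomized_cell_probe_def)
      have "(if \<not> hit x T then 9 else 0) - 13 / 3 \<le> W x T * ?p"
      proof (cases "hit x T")
        case True
        have "measure_pmf.prob D {A. ok (db T) (qu x) (answer A (db T) (qu x))}
            \<le> measure_pmf.prob D (- {A. \<not> answer A (db T) (qu x)})"
          using ok[OF x T] True by (intro measure_pmf.finite_measure_mono) auto
        also have "\<dots> = 1 - ?p" by (subst measure_pmf.prob_compl[symmetric]) (auto simp: Compl_eq_Diff_UNIV)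
        finally show ?thesis using P True by (simp add: W_def)
      next
        case False
        have "measure_pmf.prob D {A. ok (db T) (qu x) (answer A (db T) (qu x))} \<le> ?p"
          using ok[OF x T] False by (intro measure_pmf.finite_measure_mono) auto
        then show ?thesis using P False by (simp add: W_def)
      qed
      from mult_left_mono[OF this \<mu>(1)[OF T]]
      show "\<mu> T * (if \<not> hit x T then 9 else 0) - \<mu> T * (13 / 3) \<le> \<mu> T * W x T * ?p"
        by (simp add: algebra_simps)
    qed
    finally show ?thesis .
  qed
  obtain A where A: "A \<in> set_pmf D" and tot:
    "real (card X) / 7 < (\<Sum>x\<in>X. \<Sum>T\<in>\<Omega>. \<mu> T * W x T * indicator {A. \<not> answer A (db T) (qu x)} A)"
    using exists_outcome_above_expectation[OF total] by blast
  have cp: "cell_probe DB Q s w t A" using D A by (auto simp: randomized_cell_probe_def)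
  define \<Lambda> where "\<Lambda> = addresses s t \<times> contents w t"
  define AA where "AA l x \<longleftrightarrow> rejects (snd A (qu x)) (fst l) (snd l)" for l x
  define C where "C l T \<longleftrightarrow> map (fst A (db T)) (fst l) = snd l" for l T
  have unique: "card {l\<in>\<Lambda>. AA l x \<and> C l T} = (if \<not> answer A (db T) (qu x) then 1 else 0)"
    if x: "x \<in> X" and T: "T \<in> \<Omega>" for x T
  proof -
    let ?m = "fst A (db T)" and ?a = "snd A (qu x)"
    have bound: "set (probes ?m ?a) \<subseteq> {..<s}" "length (probes ?m ?a) \<le> t" "\<And>i. i < s \<Longrightarrow> length (?m i) = w"
      using cp db[OF T] qu[OF x] by (auto simp: cell_probe_def)
    then have mem: "(probes ?m ?a, map ?m (probes ?m ?a)) \<in> \<Lambda>"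
      by (auto simp: \<Lambda>_def addresses_def contents_def cube_def)
    have "{l\<in>\<Lambda>. AA l x \<and> C l T}
        = (if \<not> answer A (db T) (qu x) then {(probes ?m ?a, map ?m (probes ?m ?a))} else {})"
    proof -
      have "AA l x \<and> C l T \<longleftrightarrow> \<not> answer A (db T) (qu x) \<and> l = (probes ?m ?a, map ?m (probes ?m ?a))" for l
        using rejects_run_iff[of ?m "fst l" "snd l" ?a]
        unfolding AA_def C_def answer_def by (metis prod.collapse fst_conv snd_conv)
      with mem show ?thesis by auto
    qed
    then show ?thesis by simp
  qed
  have N1b: "real (card {l\<in>\<Lambda>. C l T}) \<le> N1" for T
  proof -
    have "card {l\<in>\<Lambda>. C l T} \<le> card (addresses s t)"
      by (rule card_inj_on_le[of fst]) (auto simp: inj_on_def C_def \<Lambda>_def)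
    also have "\<dots> \<le> (t0 + 1) * (s + 1) ^ t0" by (rule card_addresses_le[OF t])
    finally show ?thesis unfolding N1 by (rule of_nat_mono)
  qed
  have N2b: "real (card \<Lambda>) \<le> N2"
  proof -
    have "card \<Lambda> \<le> ((t0 + 1) * (s + 1) ^ t0) * ((t0 + 1) * 2 ^ (w * t0))"
      unfolding \<Lambda>_def card_cartesian_product
      by (intro mult_le_mono card_addresses_le[OF t] card_contents_le[OF t])
    then show ?thesis unfolding N1 N2 by (metis of_nat_mono of_nat_mult)
  qed
  have pos: "N1 > 0" "N2 > 0"
    unfolding N2 N1 of_nat_mult[symmetric] of_nat_0_less_iff by simp_all
  obtain l where l: "real (card {x\<in>X. 0 < (\<Sum>T\<in>{T\<in>\<Omega>. C l T}. \<mu> T * W x T)}) > real (card X) / (100 * N1)"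
    "(\<Sum>T\<in>{T\<in>\<Omega>. C l T}. \<mu> T) > 1 / (100 * N2)"
  proof (rule large_rectangle[where X = X and \<Omega> = \<Omega> and \<Lambda> = \<Lambda> and \<mu> = \<mu> and W = W and A = AA and C = C
        and P = "\<lambda>x T. \<not> answer A (db T) (qu x)" and ?N1.0 = N1 and ?N2.0 = N2])
    show "real (card X) / 7 < (\<Sum>x\<in>X. \<Sum>T\<in>\<Omega>. \<mu> T * W x T * (if \<not> answer A (db T) (qu x) then 1 else 0))"
      using tot unfolding indicator_def mem_Collect_eq of_bool_def .
  qed (use fin X \<mu> unique N1b N2b pos in \<open>auto simp: W_def \<Lambda>_def\<close>)
  show thesis
  proof (rule that[of "{T\<in>\<Omega>. C l T}"])
    let ?\<T> = "{T\<in>\<Omega>. C l T}"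
    have "card {x\<in>X. 0 < (\<Sum>T\<in>?\<T>. \<mu> T * W x T)}
        \<le> card {x\<in>X. (\<Sum>T\<in>{T\<in>?\<T>. \<not> hit x T}. \<mu> T) \<ge> 13 / 20 * (\<Sum>T\<in>?\<T>. \<mu> T)}"
    proof (rule card_mono)
      show "{x\<in>X. 0 < (\<Sum>T\<in>?\<T>. \<mu> T * W x T)}
        \<subseteq> {x\<in>X. (\<Sum>T\<in>{T\<in>?\<T>. \<not> hit x T}. \<mu> T) \<ge> 13 / 20 * (\<Sum>T\<in>?\<T>. \<mu> T)}"
      proof safe
        fix x assume "0 < (\<Sum>T\<in>?\<T>. \<mu> T * W x T)"
        also have "(\<Sum>T\<in>?\<T>. \<mu> T * W x T) = (\<Sum>T\<in>?\<T>. 20 * (if \<not> hit x T then \<mu> T else 0) - 13 * \<mu> T)"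
          by (intro sum.cong) (auto simp: W_def)
        also have "\<dots> = 20 * (\<Sum>T\<in>{T\<in>?\<T>. \<not> hit x T}. \<mu> T) - 13 * (\<Sum>T\<in>?\<T>. \<mu> T)"
          using fin by (simp only: sum_subtractf sum_distrib_left[symmetric]) (subst sum.inter_filter, auto)
        finally show "(\<Sum>T\<in>{T\<in>?\<T>. \<not> hit x T}. \<mu> T) \<ge> 13 / 20 * (\<Sum>T\<in>?\<T>. \<mu> T)" by simp
      qed
    qed (use fin in auto)
    with l(1) show "real (card {x\<in>X. (\<Sum>T\<in>{T\<in>?\<T>. \<not> hit x T}. \<mu> T) \<ge> 13 / 20 * (\<Sum>T\<in>?\<T>. \<mu> T)})
       > real (card X) / (100 * N1)" by linarith
  qed (use l(2) in auto)
qed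

text \<open>\<open>db\<close> and \<open>qu\<close> form any embedding of disjointness that is
  faithful on at least half of the tuples. By \<open>sparse\<close>, fixing more than a tenth of the
  coordinates would raise the density by more than \<open>200 * N1\<close>. The conclusion confronts
  the lower bound for the weight of the rectangle with the upper bound
  \<open>(99 / 100) ^ m\<close>; it fails once \<open>m\<close> is large.\<close>

theorem blocked_disjointness_lower_bound:
  fixes D :: "('db, 'q) data_structure pmf" and db :: "(nat \<times> nat) set \<Rightarrow> 'db" 
    and qu :: "(nat \<Rightarrow> nat) \<Rightarrow> 'q"
  assumes pos: "k > 0" "m > 0" "B > 0"
    and X: "X \<subseteq> tuples k B" "B ^ k \<le> 2 * card X"
    and D: "randomized_cell_probe DB Q ok s w t D"
    and db: "\<And>T. T \<subseteq> {..<k} \<times> {..<B} \<Longrightarrow> db T \<in> DB" and qu: "\<And>x. x \<in> X \<Longrightarrow> qu x \<in> Q"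
    and ok: "\<And>x T b. x \<in> X \<Longrightarrow> T \<subseteq> {..<k} \<times> {..<B} \<Longrightarrow> ok (db T) (qu x) b \<Longrightarrow>
      b \<longleftrightarrow> (\<exists>i<k. (i, x i) \<in> T)"
    and t: "t \<le> t0" and N1: "N1 = real ((t0 + 1) * (s + 1) ^ t0)"
    and sparse: "\<And>j. k < 10 * j \<Longrightarrow> j \<le> k \<Longrightarrow> 200 * N1 * real (k * m) ^ j < real B ^ j"
  shows "1 < 100 * (N1 * real ((t0 + 1) * 2 ^ (w * t0))) * (99 / 100) ^ m"
proof -
  define U where "U = {..<k} \<times> {..<B}"
  define \<rho> :: real where "\<rho> = 2 powr (- 1 / real k)"
  define V where "V I x = (\<lambda>i. (i, x i :: nat)) ` I" for I :: "nat set" and x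
  have finU: "finite U" by (simp add: U_def)
  have \<rho>: "0 < \<rho>" "\<rho> \<le> 1"
    using powr_mono[of "- 1 / real k" 0 2] by (auto simp: \<rho>_def)
  have \<rho>_pow: "\<rho> ^ c = 2 powr (- real c / real k)" for c
    by (simp add: \<rho>_def powr_powr flip: powr_realpow)
  have VU: "V I x \<subseteq> U" if "x \<in> X" "I \<subseteq> {..<k}" for x I
    using that X by (auto simp: V_def U_def)
  have cV: "card (V I x) = card I" for I x
    unfolding V_def by (intro card_image) (auto simp: inj_on_def)
  have hit: "(\<exists>i<k. (i, x i) \<in> T) \<longleftrightarrow> T \<inter> V {..<k} x \<noteq> {}" for x T by (auto simp: V_def)
  have X0: "finite X" "card X > 0"
  proof -
    show "finite X" using X finite_subset[OF _ finite_tuples] by auto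
    have "0 < B ^ k" using pos by simp
    with X(2) show "card X > 0" by linarith
  qed
  define N2 where "N2 = N1 * real ((t0 + 1) * 2 ^ (w * t0))"
  have N1p: "N1 > 0" unfolding N1 of_nat_0_less_iff by simp
  obtain \<T> where \<T>: "\<T> \<subseteq> Pow U" "(\<Sum>T\<in>\<T>. product_weight \<rho> U T) > 1 / (100 * N2)"
    "real (card {x\<in>X. (\<Sum>T\<in>{T\<in>\<T>. \<not> (\<exists>i<k. (i, x i) \<in> T)}. product_weight \<rho> U T)
        \<ge> 13 / 20 * (\<Sum>T\<in>\<T>. product_weight \<rho> U T)}) > real (card X) / (100 * N1)"
  proof (rule hard_rectangle[where X = X and \<Omega> = "Pow U" and \<mu> = "product_weight \<rho> U" and D = D and DB = DB
        and Q = Q and ok = ok and s = s and w = w and t = t and db = db and qu = qu and ?t0.0 = t0 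
        and hit = "\<lambda>x T. \<exists>i<k. (i, x i) \<in> T"])
    fix x assume x: "x \<in> X"
    show "(\<Sum>T\<in>{T\<in>Pow U. \<not> (\<exists>i<k. (i, x i) \<in> T)}. product_weight \<rho> U T) = 1 / 2"
      using sum_product_weight_avoiding[OF finU VU[OF x order.refl], of \<rho>] pos
      by (simp add: hit \<rho>_pow cV powr_minus_divide)
  qed (use finU X0 D db qu ok t N1 N2_def \<rho> in
        \<open>auto simp: U_def sum_product_weight product_weight_nonneg\<close>)
  define Y where "Y = {x\<in>X. (\<Sum>T\<in>{T\<in>\<T>. T \<inter> V {..<k} x = {}}. product_weight \<rho> U T)
        \<ge> 13 / 20 * (\<Sum>T\<in>\<T>. product_weight \<rho> U T)}"
  have Y: "real (card Y) > real (card X) / (100 * N1)" using \<T>(3) by (simp add: Y_def hit)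
  have "0 \<le> real (card X) / (100 * N1)" using N1p by simp
  with Y have "card Y > 0" by linarith
  then have Y': "Y \<subseteq> tuples k B" "Y \<noteq> {}" using X by (auto simp: Y_def card_gt_0_iff)
  have "k * m > 0" using pos by simp
  obtain J Z where J: "J \<subseteq> {..<k}" and Z: "Z \<subseteq> Y" "Z \<noteq> {}"
    and dens: "real (card Y) * real B ^ card J \<le> real B ^ k * real (k * m) ^ card J"
    and light: "\<And>i v. i \<in> {..<k} - J \<Longrightarrow> card {x\<in>Z. x i = v} * (k * m) \<le> card Z"
    by (rule fix_heavy_coordinates[OF Y' \<open>k * m > 0\<close>]) (rule that)
  have cJ: "card J \<le> k" using card_mono[OF _ J] by simp
  \<comment> \<open>The 200 is 100 from the rectangle times 2, because \<open>X\<close> contains at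
    least half of all tuples.\<close>
  have "\<not> k < 10 * card J"
  proof
    assume "k < 10 * card J"
    from sparse[OF this cJ] have "200 * N1 * real (k * m) ^ card J < real B ^ card J" .
    then have "real (card Y) * (200 * N1 * real (k * m) ^ card J) \<le> real (card Y) * real B ^ card J"
      by (intro mult_left_mono) auto
    also have "\<dots> \<le> real B ^ k * real (k * m) ^ card J" by (rule dens)
    finally have "(real (card Y) * (200 * N1)) * real (k * m) ^ card J \<le> real B ^ k * real (k * m) ^ card J"
      by (simp add: mult_ac)
    then have "real (card Y) * (200 * N1) \<le> real B ^ k" using pos by simp
    moreover have "real B ^ k \<le> 2 * real (card X)"
      using X(2) by (metis of_nat_le_iff of_nat_mult of_nat_numeral of_nat_power)
    ultimately show False using Y N1p by (simp add: field_simps)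
  qed
  define I where "I = {..<k} - J"
  have cI: "card I = k - card J" using J by (simp add: I_def card_Diff_subset finite_subset)
  have "card I > 0" using cI \<open>\<not> k < 10 * card J\<close> pos by linarith
  then have I: "finite I" "I \<noteq> {}" "card I \<le> k" "I \<subseteq> {..<k}"
    using cI by (auto simp: I_def card_gt_0_iff)
  have finZ: "finite Z" using Z X0 by (auto simp: Y_def intro: finite_subset)
  obtain F where F: "F \<subseteq> Z" "card F = m"
    and sep: "\<And>x x' i. x \<in> F \<Longrightarrow> x' \<in> F \<Longrightarrow> x \<noteq> x' \<Longrightarrow> i \<in> I \<Longrightarrow> x i \<noteq> x' i"
    by (rule disjoint_subfamily[OF finZ Z(2) I(1-3) light[folded I_def]]) (auto intro: that)
  have FX: "F \<subseteq> X" using F Z by (auto simp: Y_def)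
  have "(\<Sum>T\<in>\<T>. product_weight \<rho> U T) \<le> ((1 + \<rho> ^ card I) / 2 powr (13 / 20)) ^ card F"
  proof (rule weight_of_often_avoiding_family[of U F "V I"])
    fix x assume x: "x \<in> F"
    have "13 / 20 * (\<Sum>T\<in>\<T>. product_weight \<rho> U T) 
        \<le> (\<Sum>T\<in>{T\<in>\<T>. T \<inter> V {..<k} x = {}}. product_weight \<rho> U T)"
      using x F Z by (auto simp: Y_def)
    \<comment> \<open>Forgetting the coordinates in \<open>J\<close> only makes avoidance easier, so
      the fraction 13/20 survives, and on \<open>I\<close> the sets are disjoint.\<close>
    also have "\<dots> \<le> (\<Sum>T\<in>{T\<in>\<T>. T \<inter> V I x = {}}. product_weight \<rho> U T)"
    proof (rule sum_mono2)
      have "finite \<T>" by (rule finite_subset[OF \<T>(1)]) (simp add: finU)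
      then show "finite {T\<in>\<T>. T \<inter> V I x = {}}" by simp
      have "V I x \<subseteq> V {..<k} x" unfolding V_def by (rule image_mono[OF I(4)])
      then show "{T\<in>\<T>. T \<inter> V {..<k} x = {}} \<subseteq> {T\<in>\<T>. T \<inter> V I x = {}}"
        by (intro Collect_mono) (metis Int_mono order.refl subset_empty)
    qed (use \<rho> in \<open>auto intro!: product_weight_nonneg\<close>)
    finally show "13 / 20 * (\<Sum>T\<in>\<T>. product_weight \<rho> U T)
        \<le> (\<Sum>T\<in>{T\<in>\<T>. T \<inter> V I x = {}}. product_weight \<rho> U T)" .
  next
    show "disjoint_family_on (V I) F"
      unfolding disjoint_family_on_def
    proof (intro ballI impI)
      fix x x' assume "x \<in> F" "x' \<in> F" "x \<noteq> x'"
      then show "V I x \<inter> V I x' = {}" using sep by (force simp: V_def)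
    qed
    show "finite F" using FX X0(1) by (rule finite_subset)
    show "V I x \<subseteq> U" if "x \<in> F" for x using VU[OF _ I(4)] FX that by blast
  qed (use finU cV \<rho> \<T>(1) in auto)
  also have "\<dots> \<le> (99 / 100) ^ m"
    unfolding F(2)
  proof (rule power_mono)
    have "9 * real k \<le> 10 * real (card I)" using \<open>\<not> k < 10 * card J\<close> cI by simp
    then have "\<rho> ^ card I \<le> 2 powr (-9 / 10)"
      unfolding \<rho>_pow using pos by (intro powr_mono) (auto simp: field_simps)
    then have "(1 + \<rho> ^ card I) / 2 powr (13 / 20) \<le> (1 + 2 powr (-9 / 10)) / 2 powr (13 / 20)"
      by (intro divide_right_mono) auto
    also have "\<dots> \<le> 99 / 100" by (rule avoidance_constant)
    finally show "(1 + \<rho> ^ card I) / 2 powr (13 / 20) \<le> 99 / 100" .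
  qed (use \<rho> in auto)
  finally have "1 / (100 * N2) < (99 / 100) ^ m" using \<T>(2) by linarith
  moreover have "N2 > 0"
    unfolding N2_def by (intro mult_pos_pos N1p) (subst of_nat_0_less_iff, simp)
  ultimately have "1 < (99 / 100) ^ m * (100 * N2)" by (subst (asm) pos_divide_less_eq) auto
  then show ?thesis by (simp only: N2_def mult_ac)
qed

section \<open>The majority gadget\<close>

text \<open>\<open>C\<close> is one column of the random code: the elements whose point has bit 1 in
  that coordinate. Ties give bit 0.\<close>

definition majority :: "'a set \<Rightarrow> 'a set \<Rightarrow> bool" where
  "majority V C \<longleftrightarrow> card V < 2 * card (V \<inter> C)"

text \<open>The Hamming distance from the point of \<open>e\<close> to the query point of
  \<open>V\<close>, for a code given by its columns \<open>u j\<close>.\<close>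

definition disagreement :: "nat \<Rightarrow> 'a \<Rightarrow> 'a set \<Rightarrow> (nat \<Rightarrow> 'a set) \<Rightarrow> nat" where
  "disagreement D e V u = card {j\<in>{..<D}. (e \<in> u j) \<noteq> majority V (u j)}"

text \<open>
  The probability that the other \<open>k - 1\<close> voters are balanced so that a given voter decides;
  it equals the correlation of one vote with the majority.
\<close>

definition pivotal :: "nat \<Rightarrow> real" where
  "pivotal k = real ((k - 1) choose (k div 2)) / 2 ^ (k - 1)"

lemma sum_Pow_remove:
  fixes g :: "'a set \<Rightarrow> real"
  assumes "finite U" "e \<in> U"
  shows "(\<Sum>C\<in>Pow U. g C) = (\<Sum>C\<in>Pow (U - {e}). g C + g (insert e C))"
proof -
  have "Pow U = Pow (U - {e}) \<union> insert e ` Pow (U - {e})"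
    using assms(2) by (metis Pow_insert insert_Diff)
  then have "(\<Sum>C\<in>Pow U. g C) = (\<Sum>C\<in>Pow (U - {e}). g C) + (\<Sum>C\<in>insert e ` Pow (U - {e}). g C)"
    using assms(1) by (simp only:) (rule sum.union_disjoint, auto)
  also have "(\<Sum>C\<in>insert e ` Pow (U - {e}). g C) = (\<Sum>C\<in>Pow (U - {e}). g (insert e C))"
    by (subst sum.reindex) (auto simp: inj_on_def)
  finally show ?thesis by (simp add: sum.distrib)
qed

lemma card_Pow_remove: "finite U \<Longrightarrow> e \<in> U \<Longrightarrow> 2 * card (Pow (U - {e})) = 2 ^ card U"
  by (cases "card U") (auto simp: card_Pow)

text \<open>The vote of \<open>e\<close> does not influence the majority, so exactly one of
  \<open>C\<close> and \<open>insert e C\<close> disagrees: the bit is a fair coin.\<close>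

lemma sum_disagree_outside:
  assumes "finite U" "e \<in> U" "e \<notin> V"
  shows "(\<Sum>C\<in>Pow U. if (e \<in> C) \<noteq> majority V C then z else 1) = 2 ^ card U * ((1 + z) / 2 :: real)"
proof -
  have "(\<Sum>C\<in>Pow U. if (e \<in> C) \<noteq> majority V C then z else 1) = (\<Sum>C\<in>Pow (U - {e}). 1 + z)"
    unfolding sum_Pow_remove[OF assms(1,2)] using assms(3)
    by (intro sum.cong) (auto simp: majority_def)
  also have "\<dots> = real (2 * card (Pow (U - {e}))) * ((1 + z) / 2)" by simp
  finally show ?thesis unfolding card_Pow_remove[OF assms(1,2)] by simp
qed

lemma card_Pow_inter:
  assumes "finite U" "V \<subseteq> U"
  shows "card {C\<in>Pow U. card (C \<inter> V) = h} = (card V choose h) * 2 ^ card (U - V)"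
proof -
  have fV: "finite V" using assms finite_subset by auto
  have "bij_betw (\<lambda>(A, C). A \<union> C) ({A. A \<subseteq> V \<and> card A = h} \<times> Pow (U - V)) {C\<in>Pow U. card (C \<inter> V) = h}"
  proof (rule bij_betw_byWitness[where f' = "\<lambda>C. (C \<inter> V, C - V)"])
    show "(\<lambda>(A, C). A \<union> C) ` ({A. A \<subseteq> V \<and> card A = h} \<times> Pow (U - V)) \<subseteq> {C\<in>Pow U. card (C \<inter> V) = h}"
    proof safe
      fix A C assume *: "A \<subseteq> V" "C \<subseteq> U - V"
      then have "(A \<union> C) \<inter> V = A" by auto
      then show "card ((A \<union> C) \<inter> V) = card A" by simp
    qed (use assms in auto)
  qed (use assms in auto)
  from bij_betw_same_card[OF this] show ?thesis
    using assms(1) by (simp add: card_cartesian_product n_subsets[OF fV] card_Pow)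
qed

text \<open>Pair \<open>C\<close> with \<open>insert e C\<close>. If exactly
  \<open>card V div 2\<close> of the other voters lie in \<open>C\<close>, the vote of
  \<open>e\<close> decides and both sets agree with the majority; otherwise exactly one does. This
  holds for both parities of \<open>card V\<close>.\<close>

lemma sum_disagree_inside:
  fixes y :: real
  assumes U: "finite U" and V: "V \<subseteq> U" "e \<in> V"
  shows "(\<Sum>C\<in>Pow U. if (e \<in> C) \<noteq> majority V C then y else 1)
    = 2 ^ card U * ((1 + pivotal (card V)) / 2 + y * ((1 - pivotal (card V)) / 2))"
proof -
  let ?k = "card V" and ?V = "V - {e}" and ?U = "U - {e}"
  have fV: "finite V" and eU: "e \<in> U" using assms finite_subset by auto
  have "?k > 0" using fV V by (auto simp: card_gt_0_iff)
  have "(\<Sum>C\<in>Pow U. if (e \<in> C) \<noteq> majority V C then y else 1)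
      = (\<Sum>C\<in>Pow ?U. (1 + y) + (if card (C \<inter> ?V) = ?k div 2 then 1 - y else 0))"
    unfolding sum_Pow_remove[OF U eU]
  proof (rule sum.cong)
    fix C assume C: "C \<in> Pow ?U"
    have 1: "V \<inter> C = C \<inter> ?V" using C by auto
    have "card (V \<inter> insert e C) = card (insert e (C \<inter> ?V))" using C V by (intro arg_cong[of _ _ card]) auto
    also have "\<dots> = Suc (card (C \<inter> ?V))" using C fV by simp
    finally show "(if (e \<in> C) \<noteq> majority V C then y else 1)
        + (if (e \<in> insert e C) \<noteq> majority V (insert e C) then y else 1)
        = (1 + y) + (if card (C \<inter> ?V) = ?k div 2 then 1 - y else 0)"
      using C by (auto simp: majority_def 1)
  qed simp
  also have "\<dots> = real (card (Pow ?U)) * (1 + y) + real (card {C\<in>Pow ?U. card (C \<inter> ?V) = ?k div 2}) * (1 - y)"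
    using U by (simp add: sum.distrib flip: sum.inter_filter)
  also have "card {C\<in>Pow ?U. card (C \<inter> ?V) = ?k div 2} = ((?k - 1) choose (?k div 2)) * 2 ^ card (?U - ?V)"
    using U V fV by (subst card_Pow_inter) auto
  also have "card (?U - ?V) = card U - ?k"
  proof -
    have "?U - ?V = U - V" using V by auto
    then show ?thesis using V fV by (simp add: card_Diff_subset)
  qed
  also have "real (card (Pow ?U)) = 2 ^ card U / 2"
    using arg_cong[OF card_Pow_remove[OF U eU], of real] by simp
  also have "real (((?k - 1) choose (?k div 2)) * 2 ^ (card U - ?k)) = 2 ^ card U / 2 * pivotal ?k"
  proof -
    have "card U = (card U - ?k) + (?k - 1) + 1"
      using card_mono[OF U V(1)] \<open>?k > 0\<close> by simp
    then have "(2::real) ^ card U = 2 ^ (card U - ?k) * 2 ^ (?k - 1) * 2"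
      by (metis power_add power_one_right)
    then show ?thesis by (simp add: pivotal_def)
  qed
  finally show ?thesis by (simp add: field_simps)
qed

text \<open>The columns are independent, so the generating function of the distance factors over the
  coordinates.\<close>

lemma sum_power_disagreement:
  fixes z :: real
  assumes "finite U"
  shows "(\<Sum>u\<in>{..<D} \<rightarrow>\<^sub>E Pow U. z ^ disagreement D e V u)
    = (\<Sum>C\<in>Pow U. if (e \<in> C) \<noteq> majority V C then z else 1) ^ D"
proof -
  have "(\<Sum>C\<in>Pow U. if (e \<in> C) \<noteq> majority V C then z else 1) ^ D
      = (\<Prod>j<D. \<Sum>C\<in>Pow U. if (e \<in> C) \<noteq> majority V C then z else 1)" by simp
  also have "\<dots> = (\<Sum>u\<in>{..<D} \<rightarrow>\<^sub>E Pow U. \<Prod>j<D. if (e \<in> u j) \<noteq> majority V (u j) then z else 1)"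
    using assms by (intro prod_sum_PiE) auto
  also have "\<dots> = (\<Sum>u\<in>{..<D} \<rightarrow>\<^sub>E Pow U. z ^ disagreement D e V u)"
    unfolding disagreement_def by (intro sum.cong refl) (simp flip: prod.inter_filter)
  finally show ?thesis ..
qed

text \<open>Markov's inequality in counting form, used for both Chernoff bounds.\<close>

lemma card_le_sum_weight:
  fixes f :: "'u \<Rightarrow> real"
  assumes "finite S" "\<And>u. u \<in> S \<Longrightarrow> f u \<ge> 0" "\<And>u. u \<in> S \<Longrightarrow> P u \<Longrightarrow> f u \<ge> 1"
  shows "real (card {u\<in>S. P u}) \<le> (\<Sum>u\<in>S. f u)"
proof -
  have "real (card {u\<in>S. P u}) = (\<Sum>u\<in>{u\<in>S. P u}. 1)" by simp
  also have "\<dots> \<le> (\<Sum>u\<in>{u\<in>S. P u}. f u)" using assms(3) by (intro sum_mono) auto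
  also have "\<dots> \<le> (\<Sum>u\<in>S. f u)" using assms by (intro sum_mono2) auto
  finally show ?thesis .
qed

lemma card_columns: "finite U \<Longrightarrow> real (card ({..<D} \<rightarrow>\<^sub>E Pow U)) = (2 ^ card U) ^ D"
  by (simp add: card_PiE card_Pow)

text \<open>Chernoff bound for the lower tail of a binomial variable with mean D/2, with
  \<open>z\<close> at most 1 as the base of the exponential weight.\<close>

lemma card_far_failures:
  assumes U: "finite U" "e \<in> U" "e \<notin> V" and z: "0 < z" "z \<le> 1"
  shows "real (card {u\<in>{..<D} \<rightarrow>\<^sub>E Pow U. real (disagreement D e V u) < R})
    \<le> real (card ({..<D} \<rightarrow>\<^sub>E Pow U)) * (z powr (-R) * ((1 + z) / 2) ^ D)"
proof -
  have "real (card {u\<in>{..<D} \<rightarrow>\<^sub>E Pow U. real (disagreement D e V u) < R})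
      \<le> (\<Sum>u\<in>{..<D} \<rightarrow>\<^sub>E Pow U. z powr (-R) * z ^ disagreement D e V u)"
  proof (rule card_le_sum_weight)
    fix u assume "real (disagreement D e V u) < R"
    then have "1 \<le> z powr (- R + real (disagreement D e V u))"
      using powr_mono'[of "- R + real (disagreement D e V u)" 0 z] z by simp
    also have "\<dots> = z powr (-R) * z ^ disagreement D e V u"
      unfolding powr_add using z by (simp add: powr_realpow)
    finally show "1 \<le> z powr (-R) * z ^ disagreement D e V u" .
  qed (use U z in \<open>auto intro!: finite_PiE\<close>)
  also have "\<dots> = z powr (-R) * (2 ^ card U * ((1 + z) / 2)) ^ D"
    unfolding sum_distrib_left[symmetric] sum_power_disagreement[OF U(1)] sum_disagree_outside[OF U] ..
  also have "\<dots> = real (card ({..<D} \<rightarrow>\<^sub>E Pow U)) * (z powr (-R) * ((1 + z) / 2) ^ D)"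
    unfolding card_columns[OF U(1)] power_mult_distrib by (rule mult.left_commute)
  finally show ?thesis .
qed

text \<open>Chernoff bound for the upper tail. Selected points disagree with probability (1 -
  \<open>pivotal\<close>)/2 per coordinate; any lower bound \<open>r\<close> for
  \<open>pivotal\<close> may be inserted, as the moment only grows.\<close>

lemma card_near_failures:
  assumes U: "finite U" and V: "V \<subseteq> U" "e \<in> V" and y: "1 \<le> y" and r: "r \<le> pivotal (card V)" "0 \<le> r"
  shows "real (card {u\<in>{..<D} \<rightarrow>\<^sub>E Pow U. L < disagreement D e V u})
    \<le> real (card ({..<D} \<rightarrow>\<^sub>E Pow U)) * ((1 + (1 - r) / 2 * (y - 1)) ^ D / y ^ Suc L)"
proof -
  have p1: "pivotal (card V) \<le> 1"
  proof -
    have "real ((card V - 1) choose (card V div 2)) \<le> real (2 ^ (card V - 1))"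
      by (rule of_nat_mono, rule binomial_le_pow2)
    then show ?thesis by (simp add: pivotal_def)
  qed
  have "real (card {u\<in>{..<D} \<rightarrow>\<^sub>E Pow U. L < disagreement D e V u})
      \<le> (\<Sum>u\<in>{..<D} \<rightarrow>\<^sub>E Pow U. 1 / y ^ Suc L * y ^ disagreement D e V u)"
  proof (rule card_le_sum_weight)
    fix u assume "L < disagreement D e V u"
    then have "y ^ Suc L \<le> y ^ disagreement D e V u"
      using y by (intro power_increasing) auto
    then show "1 \<le> 1 / y ^ Suc L * y ^ disagreement D e V u"
      using y by (simp add: field_simps)
  qed (use U y in \<open>auto intro!: finite_PiE\<close>)
  also have "\<dots> = 1 / y ^ Suc L * (2 ^ card U * ((1 + pivotal (card V)) / 2 + y * ((1 - pivotal (card V)) / 2))) ^ D"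
    unfolding sum_distrib_left[symmetric] sum_power_disagreement[OF U] sum_disagree_inside[OF U V] ..
  also have "\<dots> \<le> 1 / y ^ Suc L * (2 ^ card U * (1 + (1 - r) / 2 * (y - 1))) ^ D"
  proof (intro mult_left_mono power_mono)
    have "r * (y - 1) \<le> pivotal (card V) * (y - 1)" using r y by (intro mult_right_mono) auto
    then show "(1 + pivotal (card V)) / 2 + y * ((1 - pivotal (card V)) / 2) \<le> 1 + (1 - r) / 2 * (y - 1)"
      by (simp add: field_simps)
  qed (use y p1 r in auto)
  also have "\<dots> = real (card ({..<D} \<rightarrow>\<^sub>E Pow U)) * ((1 + (1 - r) / 2 * (y - 1)) ^ D / y ^ Suc L)"
    unfolding card_columns[OF U] power_mult_distrib by simp
  finally show ?thesis .
qed

text \<open>Double counting of good pairs. A single code has to serve all queries, which is why only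
  half of the tuples are kept.\<close>

lemma exists_good_for_half:
  assumes fin: "finite S" "finite X" "S \<noteq> {}"
    and good: "\<And>x. x \<in> X \<Longrightarrow> card S \<le> 2 * card {u\<in>S. G x u}"
  obtains u where "u \<in> S" "card X \<le> 2 * card {x\<in>X. G x u}"
proof (rule ccontr)
  assume neg: "\<not> thesis"
  note found = that
  have "2 * card {x\<in>X. G x u} < card X" if "u \<in> S" for u
    using found[OF that] neg by (meson not_le)
  then have "(\<Sum>u\<in>S. 2 * card {x\<in>X. G x u}) < (\<Sum>u\<in>S. card X)"
    using fin by (intro sum_strict_mono) auto
  also have "\<dots> = (\<Sum>x\<in>X. card S)" by simp
  also have "\<dots> \<le> (\<Sum>x\<in>X. 2 * card {u\<in>S. G x u})" by (intro sum_mono good)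
  also have "\<dots> = 2 * (\<Sum>x\<in>X. \<Sum>u\<in>S. if G x u then 1 else 0)"
    using fin by (simp add: sum_distrib_left flip: sum.inter_filter)
  also have "\<dots> = 2 * (\<Sum>u\<in>S. \<Sum>x\<in>X. if G x u then 1 else 0)"
    by (subst sum.swap) (rule refl)
  also have "\<dots> = (\<Sum>u\<in>S. 2 * card {x\<in>X. G x u})"
    using fin by (simp add: sum_distrib_left flip: sum.inter_filter)
  finally show False by simp
qed

text \<open>The probabilistic method: for a fixed tuple, the union bound over its \<open>k\<close>
  selected points and at most \<open>k * B\<close> others leaves half of the codes good. The points
  \<open>pt\<close> do not depend on the tuple, so databases can be encoded without knowing the
  query.\<close>

lemma majority_gadget:
  assumes k: "k > 0" and y: "1 \<le> y" and z: "0 < z" "z \<le> 1" and r: "r \<le> pivotal k" "0 \<le> r"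
    and small: "real k * ((1 + (1 - r) / 2 * (y - 1)) ^ D / y ^ Suc L)
      + real (k * B) * (z powr (-R) * ((1 + z) / 2) ^ D) \<le> 1 / 2"
  obtains X pt qu where "X \<subseteq> tuples k B" "B ^ k \<le> 2 * card X"
    "\<And>e :: nat \<times> nat. pt e \<in> cube D" "\<And>x. qu x \<in> cube D"
    "\<And>x i. x \<in> X \<Longrightarrow> i < k \<Longrightarrow> hamming (pt (i, x i)) (qu x) \<le> L"
    "\<And>x i v. x \<in> X \<Longrightarrow> i < k \<Longrightarrow> v < B \<Longrightarrow> v \<noteq> x i \<Longrightarrow> R \<le> real (hamming (pt (i, v)) (qu x))"
proof -
  define U where "U = {..<k} \<times> {..<B}"
  define V where "V x = (\<lambda>i. (i, x i :: nat)) ` {..<k}" for x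
  define S where "S = {..<D} \<rightarrow>\<^sub>E Pow U"
  define a where "a = (1 + (1 - r) / 2 * (y - 1)) ^ D / y ^ Suc L"
  define b where "b = z powr (-R) * ((1 + z) / 2) ^ D"
  define G where "G x u \<longleftrightarrow> (\<forall>e\<in>V x. disagreement D e (V x) u \<le> L)
      \<and> (\<forall>e\<in>U - V x. R \<le> real (disagreement D e (V x) u))" for x u
  have finU: "finite U" by (simp add: U_def)
  have finS: "finite S" unfolding S_def using finU by (intro finite_PiE) auto
  have cV: "card (V x) = k" for x unfolding V_def by (subst card_image) (auto simp: inj_on_def)
  have VU: "V x \<subseteq> U" if "x \<in> tuples k B" for x using that by (auto simp: V_def U_def)
  have cU: "card U = k * B" by (simp add: U_def)
  have b0: "b \<ge> 0" using z by (simp add: b_def)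
  have half: "card S \<le> 2 * card {u\<in>S. G x u}" if x: "x \<in> tuples k B" for x
  proof -
    have "card (S - {u\<in>S. G x u}) \<le> card ((\<Union>e\<in>V x. {u\<in>S. L < disagreement D e (V x) u})
        \<union> (\<Union>e\<in>U - V x. {u\<in>S. real (disagreement D e (V x) u) < R}))"
      using finS finU by (intro card_mono) (auto simp: G_def not_le V_def)
    also have "\<dots> \<le> (\<Sum>e\<in>V x. card {u\<in>S. L < disagreement D e (V x) u})
        + (\<Sum>e\<in>U - V x. card {u\<in>S. real (disagreement D e (V x) u) < R})"
      using finU by (intro order.trans[OF card_Un_le] add_mono card_UN_le) (auto simp: V_def)
    finally have "real (card (S - {u\<in>S. G x u})) \<le> (\<Sum>e\<in>V x. real (card {u\<in>S. L < disagreement D e (V x) u}))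
        + (\<Sum>e\<in>U - V x. real (card {u\<in>S. real (disagreement D e (V x) u) < R}))"
      by (simp flip: of_nat_sum of_nat_add)
    also have "\<dots> \<le> (\<Sum>e\<in>V x. real (card S) * a) + (\<Sum>e\<in>U - V x. real (card S) * b)"
      unfolding S_def a_def b_def using finU VU[OF x] y z r cV
      by (intro add_mono sum_mono card_near_failures card_far_failures) auto
    also have "\<dots> \<le> real k * (real (card S) * a) + real (k * B) * (real (card S) * b)"
      using b0 cV card_mono[OF finU, of "U - V x"] cU
      by (auto intro!: mult_right_mono mult_nonneg_nonneg simp flip: of_nat_mult)
    also have "\<dots> = real (card S) * (real k * a + real (k * B) * b)" by (simp add: algebra_simps)
    also have "\<dots> \<le> real (card S) * (1 / 2)"
      using small unfolding a_def b_def by (intro mult_left_mono) auto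
    finally have "2 * card (S - {u\<in>S. G x u}) \<le> card S" by simp
    then show ?thesis using finS by (simp add: card_Diff_subset)
  qed
  have "S \<noteq> {}" unfolding S_def by (auto simp: PiE_eq_empty_iff)
  obtain u where u: "u \<in> S" "card (tuples k B) \<le> 2 * card {x\<in>tuples k B. G x u}"
    by (rule exists_good_for_half[where G = G, OF finS finite_tuples[of k B] \<open>S \<noteq> {}\<close> half]) (assumption, rule that)
  define pt where "pt e = map (\<lambda>j. e \<in> u j) [0..<D]" for e
  define qu where "qu x = map (\<lambda>j. majority (V x) (u j)) [0..<D]" for x
  have ham: "hamming (pt e) (qu x) = disagreement D e (V x) u" for e x
    unfolding hamming_def disagreement_def by (rule arg_cong[of _ _ card]) (auto simp: pt_def qu_def)
  show thesis
  proof (rule that[of "{x\<in>tuples k B. G x u}" pt qu])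
    show "B ^ k \<le> 2 * card {x\<in>tuples k B. G x u}" using u(2) by (simp add: card_tuples)
    show "pt e \<in> cube D" "qu x \<in> cube D" for e x by (auto simp: pt_def qu_def cube_def)
    fix x i assume x: "x \<in> {x\<in>tuples k B. G x u}" and i: "i < k"
    then show "hamming (pt (i, x i)) (qu x) \<le> L" by (auto simp: G_def ham V_def)
    fix v assume "v < B" "v \<noteq> x i"
    then have "(i, v) \<in> U - V x" using i by (auto simp: U_def V_def)
    then show "R \<le> real (hamming (pt (i, v)) (qu x))" using x by (auto simp: G_def ham)
  qed auto
qed

section \<open>Prefixes and padding points\<close>

lemma hamming_append:
  assumes "length a = length b"
  shows "hamming (a @ p) (b @ q) = hamming a b + hamming p q"
proof -
  have "{i. i < length (a @ p) \<and> (a @ p) ! i \<noteq> (b @ q) ! i}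
      = {i. i < length a \<and> a ! i \<noteq> b ! i} \<union> (\<lambda>i. length a + i) ` {i. i < length p \<and> p ! i \<noteq> q ! i}"
    (is "?A = ?B")
  proof
    show "?B \<subseteq> ?A" using assms by (auto simp: nth_append)
    show "?A \<subseteq> ?B"
    proof
      fix i assume i: "i \<in> ?A"
      show "i \<in> ?B"
      proof (cases "i < length a")
        case False
        then have "i - length a \<in> {i. i < length p \<and> p ! i \<noteq> q ! i}" "i = length a + (i - length a)"
          using i assms by (auto simp: nth_append)
        then show ?thesis by blast
      qed (use i assms in \<open>auto simp: nth_append\<close>)
    qed
  qed
  then show ?thesis
    unfolding hamming_def by (simp only:) (subst card_Un_disjoint, auto simp: card_image)
qed

text \<open>
  Complementation exchanges light and heavy prefixes, so at least half of the cube is far from all points with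
  a zero prefix; this is where the points that pad the database to its exact size come from.
\<close>

lemma card_heavy_prefix:
  assumes "2 * R \<le> real h"
  shows "2 ^ (h + D) \<le> 2 * card {y\<in>cube (h + D). R \<le> real (hamming (take h y) (replicate h False))}"
    (is "_ \<le> 2 * card ?S")
proof -
  have ham: "hamming (take h y) (replicate h False) = card {i\<in>{..<h}. y ! i}"
    and compl: "hamming (take h (map Not y)) (replicate h False) = card {i\<in>{..<h}. \<not> y ! i}" if "y \<in> cube (h + D)" for y
    using that unfolding hamming_def by (auto simp: cube_def intro!: arg_cong[of _ _ card])
  have "card (cube (h + D) - ?S) \<le> card ?S"
  proof (rule card_inj_on_le[of "map Not"])
    show "inj_on (map Not) (cube (h + D) - ?S)"
      by (rule inj_on_subset[OF inj_mapI]) (auto simp: inj_def)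
    show "map Not ` (cube (h + D) - ?S) \<subseteq> ?S"
    proof safe
      fix y assume y: "y \<in> cube (h + D)" and light: "\<not> R \<le> real (hamming (take h y) (replicate h False))"
      show "map Not y \<in> cube (h + D)" using y by (simp add: cube_def)
      have "card {i\<in>{..<h}. y ! i} + card {i\<in>{..<h}. \<not> y ! i} = card ({i\<in>{..<h}. y ! i} \<union> {i\<in>{..<h}. \<not> y ! i})"
        by (subst card_Un_disjoint) auto
      also have "{i\<in>{..<h}. y ! i} \<union> {i\<in>{..<h}. \<not> y ! i} = {..<h}" by auto
      finally show "R \<le> real (hamming (take h (map Not y)) (replicate h False))"
        using assms light unfolding ham[OF y] compl[OF y] by simp
    qed
  qed auto
  then have "card (cube (h + D)) \<le> 2 * card ?S"
    by (subst (asm) card_Diff_subset) auto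
  then show ?thesis by (simp add: card_cube)
qed

section \<open>The reduction to nearest neighbors\<close>

text \<open>Gadget points and queries get a prefix of \<open>h\<close> zeros. Padding points have
  prefixes of weight at least \<open>R\<close>, hence are far from every query, so a database can be
  filled up to exactly \<open>n\<close> points without changing answers.\<close>

theorem ann_lower_bound:
  fixes Dd :: "(bool list set \<times> nat, bool list) data_structure pmf"
  assumes pos: "k > 0" "m > 0" "B > 0" "L > 0" and kB: "k * B \<le> n"
    and y: "1 \<le> y" and z: "0 < z" "z \<le> 1" and r: "r \<le> pivotal k" "0 \<le> r"
    and small: "real k * ((1 + (1 - r) / 2 * (y - 1)) ^ D / y ^ Suc L)
      + real (k * B) * (z powr (-R) * ((1 + z) / 2) ^ D) \<le> 1 / 2"
    and R: "(1 + \<epsilon>) * real L \<le> R" "2 * R \<le> real h" and n: "2 * n \<le> 2 ^ (h + D)"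
    and Dd: "ann_data_structure \<epsilon> n (h + D) s w t Dd"
    and t: "t \<le> t0" and N1: "N1 = real ((t0 + 1) * (s + 1) ^ t0)"
    and sparse: "\<And>j. k < 10 * j \<Longrightarrow> j \<le> k \<Longrightarrow> 200 * N1 * real (k * m) ^ j < real B ^ j"
  shows "1 < 100 * (N1 * real ((t0 + 1) * 2 ^ (w * t0))) * (99 / 100) ^ m"
proof -
  obtain X pt qu where X: "X \<subseteq> tuples k B" "B ^ k \<le> 2 * card X"
    and ptc: "\<And>e :: nat \<times> nat. pt e \<in> cube D" and quc: "\<And>x. qu x \<in> cube D"
    and near: "\<And>x i. x \<in> X \<Longrightarrow> i < k \<Longrightarrow> hamming (pt (i, x i)) (qu x) \<le> L"
    and far: "\<And>x i v. x \<in> X \<Longrightarrow> i < k \<Longrightarrow> v < B \<Longrightarrow> v \<noteq> x i \<Longrightarrow> R \<le> real (hamming (pt (i, v)) (qu x))"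
    by (rule majority_gadget[OF pos(1) y z r small]) (rule that)
  define zs where "zs = replicate h False"
  define U where "U = {..<k} \<times> {..<B}"
  define pt' where "pt' e = zs @ pt e" for e
  define S where "S = {p\<in>cube (h + D). R \<le> real (hamming (take h p) zs)}"
  have finU: "finite U" and cU: "card U = k * B" by (auto simp: U_def)
  have finS: "finite S" by (simp add: S_def)
  have cS: "n \<le> card S" using card_heavy_prefix[OF R(2), of D] n by (simp add: S_def zs_def)
  have "\<exists>P. P \<subseteq> cube (h + D) \<and> card P = n \<and> pt' ` T \<subseteq> P \<and> P - pt' ` T \<subseteq> S" if T: "T \<subseteq> U" for T
  proof -
    have fT: "finite T" using T finU finite_subset by blast
    \<comment> \<open>Distinct pairs may receive the same point, so the amount of padding is
      computed from the image.\<close>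
    have "card (pt' ` T) \<le> card T" by (rule card_image_le[OF fT])
    also have "\<dots> \<le> k * B" using card_mono[OF finU T] cU by simp
    finally have cT: "card (pt' ` T) \<le> n" using kB by simp
    have "n - card (pt' ` T) \<le> card (S - pt' ` T)"
      using diff_card_le_card_Diff[of "pt' ` T" S] fT cS by simp
    then obtain S' where S': "S' \<subseteq> S - pt' ` T" "card S' = n - card (pt' ` T)"
      by (meson obtain_subset_with_card_n)
    have "card (pt' ` T \<union> S') = card (pt' ` T) + card S'"
      using S' finS fT by (intro card_Un_disjoint) (auto intro: finite_subset)
    then have "card (pt' ` T \<union> S') = n" using S' cT by simp
    moreover have "pt' ` T \<union> S' \<subseteq> cube (h + D)"
      using S' ptc by (auto simp: pt'_def zs_def cube_def S_def)
    ultimately show ?thesis using S' by (intro exI[of _ "pt' ` T \<union> S'"]) auto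
  qed
  then obtain P where P: "\<And>T. T \<subseteq> U \<Longrightarrow> P T \<subseteq> cube (h + D) \<and> card (P T) = n \<and> pt' ` T \<subseteq> P T \<and> P T - pt' ` T \<subseteq> S"
    by metis
  have ham: "hamming (pt' e) (zs @ qu x) = hamming (pt e) (qu x)" for e x
    unfolding pt'_def by (subst hamming_append) (auto simp: hamming_def)
  have hamS: "R \<le> real (hamming p (zs @ qu x))" if "p \<in> S" for p x
  proof -
    have "hamming (take h p @ drop h p) (zs @ qu x) = hamming (take h p) zs + hamming (drop h p) (qu x)"
      using that by (intro hamming_append) (auto simp: S_def cube_def zs_def)
    then show ?thesis using that by (simp add: S_def)
  qed
  show ?thesis
  proof (rule blocked_disjointness_lower_bound[where D = Dd and db = "\<lambda>T. (P T, L)" 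
        and qu = "\<lambda>x. zs @ qu x", OF pos(1-3) X Dd[unfolded ann_data_structure_def] _ _ _ t N1 sparse])
    show "(P T, L) \<in> ann_databases n (h + D)" if "T \<subseteq> {..<k} \<times> {..<B}" for T
      using P[of T] that pos by (auto simp: ann_databases_def U_def)
    show "zs @ qu x \<in> cube (h + D)" for x using quc by (simp add: cube_def zs_def)
    fix x T b assume x: "x \<in> X" and T: "T \<subseteq> {..<k} \<times> {..<B}"
      and acc: "ann_accepted \<epsilon> (P T, L) (zs @ qu x) b"
    note PT = P[OF T[folded U_def]]
    show "b \<longleftrightarrow> (\<exists>i<k. (i, x i) \<in> T)"
    proof (cases "\<exists>i<k. (i, x i) \<in> T")
      case True
      then obtain i where i: "i < k" "(i, x i) \<in> T" by auto
      with PT near[OF x i(1)] have "\<exists>p\<in>P T. hamming p (zs @ qu x) \<le> L"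
        by (intro bexI[of _ "pt' (i, x i)"]) (auto simp: ham)
      then show ?thesis using acc True by (auto simp: ann_accepted_def)
    next
      case False
      have "(1 + \<epsilon>) * real L \<le> real (hamming p (zs @ qu x))" if p: "p \<in> P T" for p
      proof (cases "p \<in> pt' ` T")
        case True
        then obtain i v where iv: "p = pt' (i, v)" "(i, v) \<in> T" by auto
        then have "i < k" "v < B" using T by auto
        moreover from this have "v \<noteq> x i" using False iv by auto
        ultimately have "R \<le> real (hamming (pt (i, v)) (qu x))" by (rule far[OF x])
        then show ?thesis using R(1) iv by (simp add: ham)
      next
        case False
        then have "p \<in> S" using PT p by blast
        from hamS[OF this, of x] R(1) show ?thesis by linarith
      qed
      then show ?thesis using acc False by (auto simp: ann_accepted_def)
    qed
  qed
qed

section \<open>Quantitative estimates for the gadget\<close>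

text \<open>The bound 4^g / (2 sqrt g) for the central binomial coefficient, squared to stay in the
  naturals. With g = \<open>Suc h\<close>, the induction step rests on 4 g (g + 1) being at most (2
  g + 1)^2.\<close>

lemma central_binomial_sqrt_bound: "16 ^ Suc h \<le> 4 * Suc h * ((2 * Suc h) choose (Suc h))\<^sup>2"
proof (induction h)
  case 0
  then show ?case by (simp add: numeral_2_eq_2)
next
  case (Suc h)
  let ?g = "Suc h"
  let ?a = "(2 * ?g) choose ?g" and ?b = "(2 * Suc ?g) choose Suc ?g"
  have "?b = 2 * (Suc (2 * ?g) choose Suc ?g)"
    using central_binomial_odd[of "Suc (2 * ?g)"] by simp
  moreover have "Suc ?g * (Suc (2 * ?g) choose Suc ?g) = Suc (2 * ?g) * ?a" by (rule Suc_times_binomial)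
  ultimately have b: "Suc ?g * ?b = 2 * Suc (2 * ?g) * ?a" by (metis mult.assoc mult.left_commute)
  have "16 ^ Suc ?g * Suc ?g \<le> 16 * (4 * ?g * ?a\<^sup>2) * Suc ?g"
    unfolding power_Suc[of _ ?g] by (intro mult_le_mono Suc order.refl)
  also have "\<dots> = 16 * (4 * ?g * Suc ?g) * ?a\<^sup>2" by (simp only: mult_ac)
  also have "\<dots> \<le> 16 * (Suc (2 * ?g))\<^sup>2 * ?a\<^sup>2"
    by (intro mult_le_mono) (auto simp: power2_eq_square algebra_simps)
  also have "\<dots> = 4 * (2 * Suc (2 * ?g) * ?a)\<^sup>2" by (simp only: power_mult_distrib) simp
  also have "\<dots> = 4 * Suc ?g * ?b\<^sup>2 * Suc ?g" unfolding b[symmetric] by (simp only: power2_eq_square mult_ac)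
  finally show ?case by (metis mult_le_cancel2 zero_less_Suc)
qed

lemma pivotal_ge:
  assumes "k > 0"
  shows "1 / (2 * sqrt (real k)) \<le> pivotal k"
proof (cases "k div 2")
  case 0
  then have "k = 1" using assms by simp
  then show ?thesis by (simp add: pivotal_def)
next
  case (Suc h)
  let ?g = "Suc h"
  \<comment> \<open>Both parities lead to the central coefficient of \<open>k div 2\<close>: for
    even \<open>k\<close> it is twice the coefficient in \<open>pivotal\<close>, and the power of 2
    doubles as well.\<close>
  have piv: "pivotal k = real ((2 * ?g) choose ?g) / 4 ^ ?g"
  proof (cases "even k")
    case True
    then have k: "k = 2 * ?g" using Suc by auto
    have "(2 * ?g) choose ?g = 2 * ((2 * ?g - 1) choose ?g)"
      using central_binomial_odd[of "Suc (2 * h)"] by simp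
    then have "real ((2 * ?g) choose ?g) = 2 * real ((2 * ?g - 1) choose ?g)" by simp
    moreover have "(4::real) ^ ?g = 2 * 2 ^ (2 * ?g - 1)"
      unfolding power_Suc[symmetric] by (simp add: power_mult)
    moreover have "2 * ?g div 2 = ?g" by simp
    ultimately show ?thesis unfolding pivotal_def k by (simp only:)
  next
    case False
    then have k: "k = Suc (2 * ?g)" using Suc by (metis odd_two_times_div_two_succ Suc_eq_plus1)
    have e: "Suc (2 * ?g) - 1 = 2 * ?g" "Suc (2 * ?g) div 2 = ?g" by simp_all
    show ?thesis unfolding pivotal_def k e by (simp add: power_mult)
  qed
  have "real (16 ^ ?g) \<le> real (4 * ?g * ((2 * ?g) choose ?g)\<^sup>2)"
    by (rule of_nat_mono, rule central_binomial_sqrt_bound)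
  also have "\<dots> \<le> 4 * real k * (real ((2 * ?g) choose ?g))\<^sup>2"
    using Suc by (simp only: of_nat_mult of_nat_power) (intro mult_right_mono mult_left_mono, auto)
  finally have *: "real (16 ^ ?g) \<le> 4 * real k * (real ((2 * ?g) choose ?g))\<^sup>2" .
  have "(4 ^ ?g)\<^sup>2 \<le> (2 * sqrt (real k) * real ((2 * ?g) choose ?g))\<^sup>2"
  proof -
    have "((4::real) ^ ?g)\<^sup>2 = real (16 ^ ?g)"
      unfolding power_mult[symmetric] mult.commute[of ?g 2] by (simp add: power_mult)
    moreover have "(2 * sqrt (real k) * real ((2 * ?g) choose ?g))\<^sup>2 = 4 * real k * (real ((2 * ?g) choose ?g))\<^sup>2"
      by (simp only: power_mult_distrib real_sqrt_pow2[OF of_nat_0_le_iff]) simp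
    ultimately show ?thesis using * by (simp only:)
  qed
  then have "4 ^ ?g \<le> 2 * sqrt (real k) * real ((2 * ?g) choose ?g)"
    by (rule power2_le_imp_le) auto
  then show ?thesis using assms unfolding piv by (simp add: field_simps)
qed

lemma bernoulli_mgf_le:
  fixes p \<tau> :: real
  assumes "0 \<le> \<tau>" "0 \<le> p"
  shows "1 + p * (exp \<tau> - 1) \<le> exp (p * \<tau> + \<tau>\<^sup>2 / 8)"
proof -
  have "1 + p * (exp \<tau> - 1) > 0" using assms by (intro add_pos_nonneg mult_nonneg_nonneg) auto
  moreover have "ln (1 + p * (exp \<tau> - 1)) \<le> p * \<tau> + \<tau>\<^sup>2 / 8"
    using Hoeffdings_lemma_aux[OF assms] by (simp add: algebra_simps)
  ultimately show ?thesis by (metis exp_le_cancel_iff exp_ln)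
qed

text \<open>The mean distances are D/2 - rD/2 for selected and D/2 for other points. The thresholds
  D/2 - rD/3 and D/2 - rD/6 leave a gap of rD/6 to each mean, for which Hoeffding's optimal
  parameter is 2r/3 and the exponent r^2 D/18.\<close>

lemma gadget_failure_bounds:
  fixes r :: real
  assumes r: "0 \<le> r" "r \<le> 1" and L: "real D / 2 - r * D / 3 \<le> real (Suc L)" and R: "R = real D / 2 - r * D / 6"
    and y: "y = exp (2 * r / 3)" and z: "z = exp (- (2 * r / 3))"
  shows "(1 + (1 - r) / 2 * (y - 1)) ^ D / y ^ Suc L \<le> exp (- (r\<^sup>2 * D / 18))"
    and "z powr (-R) * ((1 + z) / 2) ^ D \<le> exp (- (r\<^sup>2 * D / 18))"
proof -
  define \<tau> where "\<tau> = 2 * r / 3"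
  have \<tau>: "0 \<le> \<tau>" using r by (simp add: \<tau>_def)
  have "(1 + (1 - r) / 2 * (y - 1)) ^ D \<le> exp ((1 - r) / 2 * \<tau> + \<tau>\<^sup>2 / 8) ^ D"
    unfolding y using bernoulli_mgf_le[of \<tau> "(1 - r) / 2"] \<tau> r
    by (intro power_mono) (auto simp: \<tau>_def intro!: add_nonneg_nonneg mult_nonneg_nonneg)
  moreover have "exp (\<tau> * (real D / 2 - r * D / 3)) \<le> y ^ Suc L"
  proof -
    have "exp (\<tau> * (real D / 2 - r * D / 3)) \<le> exp (\<tau> * real (Suc L))"
      using L \<tau> by (intro exp_mono mult_left_mono) auto
    also have "\<dots> = y ^ Suc L" unfolding y \<tau>_def[symmetric] by (metis exp_of_nat2_mult)
    finally show ?thesis .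
  qed
  ultimately have "(1 + (1 - r) / 2 * (y - 1)) ^ D / y ^ Suc L
      \<le> exp ((1 - r) / 2 * \<tau> + \<tau>\<^sup>2 / 8) ^ D / exp (\<tau> * (real D / 2 - r * D / 3))"
    by (intro frac_le) auto
  also have "\<dots> = exp (real D * ((1 - r) / 2 * \<tau> + \<tau>\<^sup>2 / 8) - \<tau> * (real D / 2 - r * D / 3))"
    by (simp add: exp_diff exp_of_nat_mult)
  also have "real D * ((1 - r) / 2 * \<tau> + \<tau>\<^sup>2 / 8) - \<tau> * (real D / 2 - r * D / 3) = - (r\<^sup>2 * D / 18)"
    by (simp add: \<tau>_def field_simps power2_eq_square)
  finally show "(1 + (1 - r) / 2 * (y - 1)) ^ D / y ^ Suc L \<le> exp (- (r\<^sup>2 * D / 18))" .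
  have zexp: "z = exp (- \<tau>)" by (simp add: z \<tau>_def)
  \<comment> \<open>Factoring out \<open>exp (- \<tau>)\<close> passes to the complementary bit, so
    that the moment bound for nonnegative \<tau> applies.\<close>
  have "(1 + z) / 2 = exp (- \<tau>) * (1 + 1 / 2 * (exp \<tau> - 1))"
    by (simp add: zexp field_simps flip: exp_add)
  also have "\<dots> \<le> exp (- \<tau>) * exp (1 / 2 * \<tau> + \<tau>\<^sup>2 / 8)"
    using \<tau> by (intro mult_left_mono bernoulli_mgf_le) auto
  also have "\<dots> = exp (\<tau>\<^sup>2 / 8 - \<tau> / 2)" by (simp flip: exp_add)
  finally have "((1 + z) / 2) ^ D \<le> exp (\<tau>\<^sup>2 / 8 - \<tau> / 2) ^ D"
    by (intro power_mono) (auto simp: zexp intro!: add_nonneg_nonneg)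
  then have "z powr (-R) * ((1 + z) / 2) ^ D \<le> exp (\<tau> * R) * exp (\<tau>\<^sup>2 / 8 - \<tau> / 2) ^ D"
    by (intro mult_mono) (auto simp: zexp powr_def)
  also have "\<dots> = exp (\<tau> * R + real D * (\<tau>\<^sup>2 / 8 - \<tau> / 2))"
    by (simp add: exp_add exp_of_nat_mult)
  also have "\<tau> * R + real D * (\<tau>\<^sup>2 / 8 - \<tau> / 2) = - (r\<^sup>2 * D / 18)"
    by (simp add: R \<tau>_def field_simps power2_eq_square)
  finally show "z powr (-R) * ((1 + z) / 2) ^ D \<le> exp (- (r\<^sup>2 * D / 18))" .
qed

section \<open>Choice of parameters\<close>

text \<open>With r = 1/(2 sqrt k), the bound on \<epsilon> gives \<epsilon> at most r/3, which
  closes the gap between \<open>L\<close> and \<open>R\<close>. Since r^2/18 = 1/(72 k), the bound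
  on \<open>D\<close> makes each failure probability at most 1/(4n), and each of the two union
  bounds then costs 1/4.\<close>

lemma ann_lower_bound_small_eps:
  fixes Dd :: "(bool list set \<times> nat, bool list) data_structure pmf"
  assumes pos: "k > 0" "m > 0" "B > 0" and kB: "k * B \<le> n"
    and \<epsilon>: "0 < \<epsilon>" "36 * real k * \<epsilon>\<^sup>2 \<le> 1"
    and D: "3 \<le> D" "D \<le> h" "72 * real k * ln (4 * real n) \<le> real D"
    and n: "2 * n \<le> 2 ^ (h + D)" and Dd: "ann_data_structure \<epsilon> n (h + D) s w t Dd"
    and t: "t \<le> t0" and N1: "N1 = real ((t0 + 1) * (s + 1) ^ t0)"
    and sparse: "\<And>j. k < 10 * j \<Longrightarrow> j \<le> k \<Longrightarrow> 200 * N1 * real (k * m) ^ j < real B ^ j"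
  shows "1 < 100 * (N1 * real ((t0 + 1) * 2 ^ (w * t0))) * (99 / 100) ^ m"
proof -
  define r where "r = 1 / (2 * sqrt (real k))"
  define L where "L = nat \<lfloor>real D / 2 - r * D / 3\<rfloor>"
  define R where "R = real D / 2 - r * D / 6"
  define y where "y = exp (2 * r / 3)"
  define z where "z = exp (- (2 * r / 3))"
  have r0: "0 < r" using pos by (simp add: r_def)
  have "sqrt (real k) \<ge> 1" using pos by simp
  then have r1: "r \<le> 1 / 2" by (simp add: r_def field_simps)
  have rD: "r * D \<le> real D / 2" using mult_right_mono[OF r1, of "real D"] by simp
  have r2: "r\<^sup>2 = 1 / (4 * real k)" using pos by (simp add: r_def power_divide power_mult_distrib)
  have "1 \<le> real D / 2 - r * D / 3" using rD D(1) by linarith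
  then have L0: "L > 0" and L1: "real L \<le> real D / 2 - r * D / 3" "real D / 2 - r * D / 3 \<le> real (Suc L)"
    unfolding L_def by (simp_all, linarith+)
  have "(3 * \<epsilon>)\<^sup>2 \<le> r\<^sup>2" unfolding r2 using \<epsilon> pos by (simp add: field_simps power2_eq_square)
  then have er: "3 * \<epsilon> \<le> r" using less_imp_le[OF r0] by (rule power2_le_imp_le)
  have "(1 + \<epsilon>) * real L = real L + \<epsilon> * real L" by (simp add: algebra_simps)
  also have "\<dots> \<le> (real D / 2 - r * D / 3) + r / 3 * (real D / 2)"
  proof (intro add_mono mult_mono L1)
    have "0 \<le> r * real D / 3" using r0 by simp
    with L1(1) show "real L \<le> real D / 2" by linarith
  qed (use er r0 in auto)
  also have "\<dots> = R" by (simp add: R_def)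
  finally have R: "(1 + \<epsilon>) * real L \<le> R" .
  have n0: "n > 0" using kB pos by (cases n) auto
  have "exp (- (r\<^sup>2 * D / 18)) \<le> exp (- ln (4 * real n))"
    using D(3) pos by (simp add: r2 field_simps)
  also have "\<dots> = 1 / (4 * real n)" using n0 by (simp add: exp_minus inverse_eq_divide)
  finally have e: "exp (- (r\<^sup>2 * D / 18)) \<le> 1 / (4 * real n)" .
  have fails: "(1 + (1 - r) / 2 * (y - 1)) ^ D / y ^ Suc L \<le> 1 / (4 * real n)"
    "z powr (-R) * ((1 + z) / 2) ^ D \<le> 1 / (4 * real n)"
    using gadget_failure_bounds[of r D L R y z] r0 r1 L1 R_def y_def z_def e by (auto intro: order.trans)
  have kn: "real k \<le> real n" "real (k * B) \<le> real n"
    using kB pos by (auto intro: order.trans[rotated] simp flip: of_nat_mult)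
  have small: "real k * ((1 + (1 - r) / 2 * (y - 1)) ^ D / y ^ Suc L)
      + real (k * B) * (z powr (-R) * ((1 + z) / 2) ^ D) \<le> 1 / 2"
  proof -
    have "real k * ((1 + (1 - r) / 2 * (y - 1)) ^ D / y ^ Suc L) \<le> real n * (1 / (4 * real n))"
      using r0 r1 by (intro mult_mono fails kn) (auto simp: y_def intro!: divide_nonneg_nonneg zero_le_power add_nonneg_nonneg)
    moreover have "real (k * B) * (z powr (-R) * ((1 + z) / 2) ^ D) \<le> real n * (1 / (4 * real n))"
      by (intro mult_mono fails kn) (auto simp: z_def intro!: add_nonneg_nonneg)
    moreover have "real n * (1 / (4 * real n)) = 1 / 4" using n0 by simp
    ultimately show ?thesis by linarith
  qed
  show ?thesis
  proof (rule ann_lower_bound[OF pos L0 kB _ _ _ _ _ small R _ n Dd t N1 sparse])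
    show "1 \<le> y" "0 < z" "z \<le> 1" "0 \<le> r" using r0 by (auto simp: y_def z_def)
    show "r \<le> pivotal k" unfolding r_def by (rule pivotal_ge[OF pos(1)])
    have "0 \<le> r * real D / 3" using r0 by simp
    moreover have "2 * R = real D - r * real D / 3" by (simp add: R_def)
    ultimately show "2 * R \<le> real h" using D(2) by linarith
  qed
qed

text \<open>
  For \<open>\<epsilon>\<close> bounded away from 0 the dimension may be as small as \<open>log 2 n + 1\<close>, too small for concentration. Here
  \<open>k = 1\<close> and \<open>L = 1\<close>, and random points need only have constant distance \<open>1 + \<epsilon>\<close> from each other.
\<close>

lemma ann_lower_bound_large_eps:
  fixes Dd :: "(bool list set \<times> nat, bool list) data_structure pmf"
  assumes pos: "m > 0" "B > 0" and kB: "B \<le> n" and \<epsilon>: "0 < \<epsilon>" and D: "0 < D" "2 * (1 + \<epsilon>) \<le> real h"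
    and B: "real B * (3 * real D powr (1 + \<epsilon>) / 2 ^ D) \<le> 7 / 16"
    and n: "2 * n \<le> 2 ^ (h + D)" and Dd: "ann_data_structure \<epsilon> n (h + D) s w t Dd"
    and t: "t \<le> t0" and N1: "N1 = real ((t0 + 1) * (s + 1) ^ t0)"
    and sparse: "200 * N1 * real m < real B"
  shows "1 < 100 * (N1 * real ((t0 + 1) * 2 ^ (w * t0))) * (99 / 100) ^ m"
proof (rule ann_lower_bound[where k = 1 and L = 1 and r = 1 and y = 4 and z = "1 / real D" and R = "1 + \<epsilon>",
      OF _ pos _ _ _ _ _ _ _ _ _ _ n Dd t N1])
  \<comment> \<open>The choice \<open>z = 1 / D\<close> costs only a polynomial factor in
    \<open>D\<close> and keeps \<open>(1 + z) ^ D\<close> bounded.\<close>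
  have "((1 + 1 / real D) / 2) ^ D \<le> 3 / 2 ^ D"
  proof -
    have "(1 + 1 / real D) ^ D \<le> exp (1 / real D) ^ D"
      by (intro power_mono exp_ge_add_one_self) auto
    also have "\<dots> = exp 1" using D by (simp flip: exp_of_nat_mult)
    also have "\<dots> \<le> 3" by (rule exp_le)
    finally show ?thesis by (simp add: power_divide divide_right_mono)
  qed
  moreover have "(1 / real D) powr - x = real D powr x" for x
    by (simp add: powr_minus powr_divide)
  ultimately have "(1 / real D) powr - (1 + \<epsilon>) * ((1 + 1 / real D) / 2) ^ D \<le> real D powr (1 + \<epsilon>) * (3 / 2 ^ D)"
    by (simp only:) (rule mult_left_mono, auto)
  then have "real B * ((1 / real D) powr - (1 + \<epsilon>) * ((1 + 1 / real D) / 2) ^ D) 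
      \<le> real B * (3 * real D powr (1 + \<epsilon>) / 2 ^ D)"
    by (intro mult_left_mono) (auto simp: mult.commute)
  \<comment> \<open>With \<open>k = 1\<close> the query coincides with its selected point. The near
    term is then 1/4^2 = 1/16, leaving 7/16 for the far points.\<close>
  with B show "real 1 * ((1 + (1 - 1) / 2 * (4 - 1)) ^ D / 4 ^ Suc 1) 
      + real (1 * B) * ((1 / real D) powr - (1 + \<epsilon>) * ((1 + 1 / real D) / 2) ^ D) \<le> 1 / 2" by simp
  fix j :: nat assume "1 < 10 * j" "j \<le> 1"
  then have "j = 1" by simp
  then show "200 * N1 * real (1 * m) ^ j < real B ^ j" using sparse by simp
qed (use kB D in \<open>auto simp: pivotal_def\<close>)

text \<open>The exponents 1 - a, 1 - 2a and 1 - 4a of \<open>B\<close>, \<open>m\<close> and the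
  word size are separated. The first gap makes B/(k m) at least of order n^a, whose power k/10 beats
  the \<open>n powr (\<kappa> * t0)\<close> in \<open>N1\<close>; the second makes \<open>m\<close>
  dominate the number of bits read.\<close>

lemma eventually_parameters:
  fixes a K \<kappa> :: real and t0 k :: nat
  assumes k: "k > 0" and a: "0 < a" "4 * a < 1" and K: "K > 0" and \<kappa>: "0 \<le> \<kappa>" "\<kappa> * t0 < a * (k / 10)"
  defines "B \<equiv> \<lambda>n. nat \<lfloor>real n powr (1 - a) / k\<rfloor>" and "m \<equiv> \<lambda>n. nat \<lfloor>real n powr (1 - 2 * a)\<rfloor>"
    and "N1 \<equiv> \<lambda>s. real ((t0 + 1) * (s + 1) ^ t0)"
  shows "\<forall>\<^sub>F n in sequentially. 0 < B n \<and> 0 < m n \<and> k * B n \<le> n \<and>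
    (\<forall>s w. real s < real n powr \<kappa> \<longrightarrow> real w \<le> K * real n powr (1 - 4 * a) \<longrightarrow>
      (\<forall>j. k < 10 * j \<longrightarrow> 200 * N1 s * real (k * m n) ^ j < real (B n) ^ j) \<and>
      100 * (N1 s * real ((t0 + 1) * 2 ^ (w * t0))) * (99 / 100) ^ m n \<le> 1)"
proof -
  \<comment> \<open>The factor \<open>2 ^ t0\<close> absorbs the passage from \<open>s + 1\<close>
    to twice \<open>n powr \<kappa>\<close>.\<close>
  define C where "C = (real t0 + 1) * 2 ^ t0"
  have C: "C > 0" by (simp add: C_def add_pos_nonneg)
  have k': "real k / 10 > 0" "2 * (real k)\<^sup>2 > 0" "2 * real k > 0" using k by auto
  \<comment> \<open>The added 1 keeps the coefficient positive even if no cell is probed.\<close>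
  have K': "K * t0 + 1 > 0" using K by (simp add: add_nonneg_pos)
  have 1: "\<forall>\<^sub>F n in sequentially. 2 * real k \<le> real n powr (1 - a)"
    using a k'(3) by real_asymp
  have 2: "\<forall>\<^sub>F n in sequentially. 2 \<le> real n powr (1 - 2 * a)"
    using a by real_asymp
  have 3: "\<forall>\<^sub>F n in sequentially. (200 * C) * real n powr (\<kappa> * t0) < (real n powr a / (2 * (real k)\<^sup>2)) powr (k / 10)"
  proof -
    have "\<forall>\<^sub>F n in sequentially. C * real n powr b < (real n powr a / M) powr p"
      if "0 < a" "0 < p" "0 < M" "0 < C" "b < a * p" for a b p M C :: real
      using that by real_asymp
    from this[OF a(1) k'(1,2) _ \<kappa>(2), of "200 * C"] C show ?thesis by simp
  qed
  have 4: "\<forall>\<^sub>F n in sequentially. 2 * (real k)\<^sup>2 \<le> real n powr a"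
    using a k'(2) by real_asymp
  have 5: "\<forall>\<^sub>F n in sequentially. (100 * C * (real t0 + 1)) * real n powr (\<kappa> * t0) 
      * 2 powr ((K * t0 + 1) * real n powr (1 - 4 * a)) * (99 / 100) powr (real n powr (1 - 2 * a) / 2) \<le> 1"
  proof -
    have "\<forall>\<^sub>F n in sequentially. C * real n powr b * 2 powr (K * real n powr (1 - 4 * a))
        * (99 / 100) powr (real n powr (1 - 2 * a) / 2) \<le> 1"
      if "0 < K" "0 < C" for b K C :: real
      using that a by real_asymp
    from this[OF K', of "100 * C * (real t0 + 1)"] C show ?thesis by (simp add: add_pos_nonneg)
  qed
  show ?thesis
    using 1 2 3 4 5 eventually_ge_at_top[of 1]
  proof eventually_elim
    case (elim n)
    define b where "b = real n powr (1 - a)"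
    define q where "q = real n powr a / (2 * (real k)\<^sup>2)"
    have n1: "1 \<le> real n" using elim by simp
    have Bn: "real (B n) \<le> b / k" "b / (2 * k) \<le> real (B n)"
    proof -
      define x where "x = b / k"
      have "2 \<le> x" using elim(1) k by (simp add: x_def b_def field_simps)
      then have "real (B n) \<le> x" "x / 2 \<le> real (B n)"
        unfolding B_def b_def[symmetric] x_def[symmetric] by linarith+
      then show "real (B n) \<le> b / k" "b / (2 * k) \<le> real (B n)" by (auto simp: x_def field_simps)
    qed
    have mn: "real (m n) \<le> real n powr (1 - 2 * a)" "real n powr (1 - 2 * a) / 2 \<le> real (m n)"
      using elim(2) unfolding m_def by linarith+
    have "0 < b / (2 * k)" using n1 k by (simp add: b_def)
    with Bn(2) have B0: "0 < B n" by linarith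
    have m0: "0 < m n" using mn(2) elim(2) by linarith
    have "real (k * B n) \<le> b" using mult_left_mono[OF Bn(1), of "real k"] k by simp
    also have "b \<le> real n powr 1" unfolding b_def using n1 a by (intro powr_mono) auto
    finally have "real (k * B n) \<le> real n" using n1 by simp
    then have kB: "k * B n \<le> n" by (simp only: of_nat_le_iff)
    have q1: "1 \<le> q" using elim(4) k by (simp add: q_def field_simps)
    have qB: "q * real (k * m n) \<le> real (B n)"
    proof -
      have "q * real (k * m n) \<le> q * (k * real n powr (1 - 2 * a))"
        using mn(1) q1 by (simp add: mult_left_mono)
      also have "\<dots> = (real n powr a * real n powr (1 - 2 * a)) / (2 * k)"
        using k by (simp add: q_def field_simps power2_eq_square)
      also have "real n powr a * real n powr (1 - 2 * a) = b"
        by (simp add: b_def flip: powr_add)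
      finally show ?thesis using Bn(2) by linarith
    qed
    have main: "(\<forall>j. k < 10 * j \<longrightarrow> 200 * N1 s * real (k * m n) ^ j < real (B n) ^ j) \<and>
      100 * (N1 s * real ((t0 + 1) * 2 ^ (w * t0))) * (99 / 100) ^ m n \<le> 1"
      if s: "real s < real n powr \<kappa>" and w: "real w \<le> K * real n powr (1 - 4 * a)" for s w
    proof -
      have "1 \<le> real n powr \<kappa>" using n1 \<kappa> by (simp add: ge_one_powr_ge_zero)
      with s have "real (s + 1) \<le> 2 * real n powr \<kappa>" by simp
      then have "real (s + 1) ^ t0 \<le> (2 * real n powr \<kappa>) ^ t0" by (intro power_mono) auto
      also have "\<dots> = 2 ^ t0 * real n powr (\<kappa> * t0)"
        using n1 by (simp add: power_mult_distrib powr_powr flip: powr_realpow)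
      finally have "N1 s \<le> (real t0 + 1) * (2 ^ t0 * real n powr (\<kappa> * t0))"
        unfolding N1_def of_nat_mult of_nat_power by (intro mult_mono) auto
      then have N: "N1 s \<le> C * real n powr (\<kappa> * t0)" by (simp add: C_def mult_ac)
      have N0: "0 \<le> N1 s" by (simp add: N1_def)
      have "200 * N1 s * real (k * m n) ^ j < real (B n) ^ j" if j: "k < 10 * j" for j
      proof -
        have "200 * N1 s < q powr (k / 10)" using N elim(3) unfolding q_def by linarith
        also have "\<dots> \<le> q powr real j" using j q1 by (intro powr_mono) auto
        also have "\<dots> = q ^ j" using q1 by (intro powr_realpow) auto
        finally have "200 * N1 s * real (k * m n) ^ j < q ^ j * real (k * m n) ^ j"
          using k m0 by (intro mult_strict_right_mono) auto
        also have "\<dots> \<le> real (B n) ^ j"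
          unfolding power_mult_distrib[symmetric] using qB q1 by (intro power_mono) auto
        finally show ?thesis .
      qed
      moreover have "100 * (N1 s * real ((t0 + 1) * 2 ^ (w * t0))) * (99 / 100) ^ m n \<le> 1"
      proof -
        have "(2::real) ^ (w * t0) = 2 powr (real w * t0)" by (simp flip: powr_realpow)
        also have "real w * t0 \<le> K * real n powr (1 - 4 * a) * t0" using w by (intro mult_right_mono) auto
        also have "\<dots> \<le> (K * t0 + 1) * real n powr (1 - 4 * a)" by (simp add: algebra_simps)
        finally have w2: "(2::real) ^ (w * t0) \<le> 2 powr ((K * t0 + 1) * real n powr (1 - 4 * a))"
          by simp
        have "(99 / 100 :: real) ^ m n = (99 / 100) powr real (m n)" by (simp add: powr_realpow)
        also have "\<dots> \<le> (99 / 100) powr (real n powr (1 - 2 * a) / 2)"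
          using mn(2) by (intro powr_mono') auto
        finally have m2: "(99 / 100 :: real) ^ m n \<le> (99 / 100) powr (real n powr (1 - 2 * a) / 2)" .
        have "100 * (N1 s * real ((t0 + 1) * 2 ^ (w * t0))) * (99 / 100) ^ m n
            = 100 * (N1 s * ((real t0 + 1) * 2 ^ (w * t0))) * (99 / 100) ^ m n"
          by (simp add: algebra_simps)
        also have "\<dots> \<le> 100 * ((C * real n powr (\<kappa> * t0)) * ((real t0 + 1) * 2 powr ((K * t0 + 1) * real n powr (1 - 4 * a))))
            * (99 / 100) powr (real n powr (1 - 2 * a) / 2)"
          using N N0 w2 m2 C by (intro mult_mono mult_nonneg_nonneg) auto
        also have "\<dots> \<le> 1" using elim(5) by (simp add: algebra_simps)
        finally show ?thesis .
      qed
      ultimately show ?thesis by blast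
    qed
    show ?case using B0 m0 kB main by blast
  qed
qed

text \<open>The constant \<open>c\<close> is chosen before \<epsilon>, while the threshold for
  \<open>n\<close> may depend on \<epsilon>. The condition \<open>2 * n \<le> 2 ^ d\<close> ensures
  that half of the cube supplies enough padding points.\<close>

theorem theorem6p9:
  fixes \<delta> c1 c2 K :: real and T :: nat
  assumes "\<delta> > 0" and "c1 > 0" and "c2 > 0" and "K > 0"
  shows "\<exists>c>0. \<forall>\<epsilon>>0. \<forall>\<^sub>F n in sequentially. \<forall>d s w t. \<forall>D.
    c1 * log 2 (real n) / \<epsilon>\<^sup>2 \<le> real d \<longrightarrow> real d \<le> c2 * log 2 (real n) / \<epsilon>\<^sup>2 \<longrightarrow>
    2 * n \<le> 2 ^ d \<longrightarrow>
    t \<le> T \<longrightarrow>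
    real w \<le> K * real n powr (1 - \<delta>) \<longrightarrow>
    ann_data_structure \<epsilon> n d s w t D \<longrightarrow>
    real s \<ge> real n powr (c / \<epsilon>\<^sup>2)"
proof -
  define a where "a = min \<delta> (1 / 2) / 4"
  have a: "0 < a" "4 * a < 1" "4 * a \<le> \<delta>" using assms(1) by (auto simp: a_def)
  \<comment> \<open>1/36 yields \<open>36 * k * \<epsilon>\<^sup>2 \<le> 1\<close>. In 576 = 72 * 8,
    one factor 2 is for ln (4n) against ln n, one for giving the gadget half of the dimension, and
    one is slack for rounding.\<close>
  define c3 where "c3 = min (1 / 36) (c1 / 576)"
  have c3: "0 < c3" "c3 \<le> 1 / 36" "576 * c3 \<le> c1" using assms by (auto simp: c3_def)
  \<comment> \<open>20 combines the tenth of the coordinates that may be fixed with the factor 2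
    lost in rounding \<open>k\<close>; \<open>T + 1\<close> makes the inequality \<open>cT\<close>
    strict.\<close>
  define c where "c = c3 * a / (20 * (real T + 1))"
  have c: "0 < c" using c3 a by (simp add: c_def add_nonneg_pos)
  have cT: "2 * c / c3 * T < a / 10"
  proof -
    have "2 * c / c3 * T = a / 10 * (T / (real T + 1))"
    proof -
      have "2 * (c3 * a / (20 * u)) / c3 * v = a / 10 * (v / u)" for u v :: real
        using c3 by (cases "u = 0") (auto simp: field_simps)
      then show ?thesis unfolding c_def .
    qed
    also have "\<dots> < a / 10 * 1" using a by (intro mult_strict_left_mono) auto
    finally show ?thesis by simp
  qed
  show ?thesis
  proof (intro exI[of _ c] conjI c allI impI)
    fix \<epsilon> :: real assume \<epsilon>: "\<epsilon> > 0"
    define \<kappa> where "\<kappa> = c / \<epsilon>\<^sup>2"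
    have \<kappa>0: "0 \<le> \<kappa>" using c by (simp add: \<kappa>_def)
    define k where "k = max 1 (nat \<lfloor>c3 / \<epsilon>\<^sup>2\<rfloor>)"
    have k0: "k > 0" by (simp add: k_def)
    have k1: "c3 / \<epsilon>\<^sup>2 \<le> 2 * real k" unfolding k_def by linarith
    have "\<kappa> * T = (c / c3) * (c3 / \<epsilon>\<^sup>2) * T" using c3 by (simp add: \<kappa>_def)
    also have "\<dots> \<le> (c / c3) * (2 * real k) * T" using k1 c c3 by (intro mult_right_mono mult_left_mono) auto
    also have "\<dots> = (2 * c / c3 * T) * k" by simp
    also have "\<dots> < a / 10 * k" using cT k0 by (intro mult_strict_right_mono) auto
    finally have \<kappa>: "\<kappa> * T < a * (k / 10)" by simp
    note params = eventually_parameters[OF k0 a(1,2) assms(4) \<kappa>0 \<kappa>]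
    define B where "B n = nat \<lfloor>real n powr (1 - a) / k\<rfloor>" for n
    define m where "m n = nat \<lfloor>real n powr (1 - 2 * a)\<rfloor>" for n
    show "\<forall>\<^sub>F n in sequentially. \<forall>d s w t. \<forall>D. c1 * log 2 (real n) / \<epsilon>\<^sup>2 \<le> real d \<longrightarrow>
        real d \<le> c2 * log 2 (real n) / \<epsilon>\<^sup>2 \<longrightarrow> 2 * n \<le> 2 ^ d \<longrightarrow> t \<le> T \<longrightarrow>
        real w \<le> K * real n powr (1 - \<delta>) \<longrightarrow> ann_data_structure \<epsilon> n d s w t D \<longrightarrow>
        real s \<ge> real n powr (c / \<epsilon>\<^sup>2)"
    proof (cases "\<epsilon>\<^sup>2 \<le> c3")
      case True
      then have "1 \<le> c3 / \<epsilon>\<^sup>2" using \<epsilon> by simp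
      then have k2: "real k \<le> c3 / \<epsilon>\<^sup>2" unfolding k_def by linarith
      have "36 * real k * \<epsilon>\<^sup>2 \<le> 36 * (c3 / \<epsilon>\<^sup>2) * \<epsilon>\<^sup>2" using k2 by (intro mult_right_mono mult_left_mono) auto
      also have "\<dots> \<le> 1" using \<epsilon> c3 by simp
      finally have \<epsilon>k: "36 * real k * \<epsilon>\<^sup>2 \<le> 1" .
      \<comment> \<open>From 4 on, ln n is at least 1 and ln (4n) is at most 2 ln n.\<close>
      show ?thesis using params eventually_ge_at_top[of 4]
      proof eventually_elim
        case (elim n)
        show ?case
        proof (intro allI impI)
          fix d s w t D
          assume d: "c1 * log 2 (real n) / \<epsilon>\<^sup>2 \<le> real d" and n: "2 * n \<le> 2 ^ d" and t: "t \<le> T"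
            and w: "real w \<le> K * real n powr (1 - \<delta>)" and D: "ann_data_structure \<epsilon> n d s w t D"
          show "real s \<ge> real n powr (c / \<epsilon>\<^sup>2)"
          proof (rule ccontr)
            assume "\<not> ?thesis"
            then have s: "real s < real n powr \<kappa>" by (simp add: \<kappa>_def)
            have "real n powr (1 - \<delta>) \<le> real n powr (1 - 4 * a)" using a elim(2) by (intro powr_mono) auto
            with assms(4) have w': "real w \<le> K * real n powr (1 - 4 * a)"
              by (intro order.trans[OF w] mult_left_mono) auto
            have ln4: "1 \<le> ln (real n)"
              using ln_mono[of "exp 1" "real n"] exp_le elim(2) by simp
            have "576 * real k * ln (real n) \<le> 576 * (c3 / \<epsilon>\<^sup>2) * log 2 (real n)"
            proof (intro mult_mono mult_left_mono k2)
              have "ln 2 * ln (real n) \<le> 1 * ln (real n)" using ln4 ln_2_less_1 by (intro mult_right_mono) auto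
              then show "ln (real n) \<le> log 2 (real n)" by (simp add: log_def field_simps)
            qed (use ln4 c3 in auto)
            also have "\<dots> = 576 * c3 * log 2 (real n) / \<epsilon>\<^sup>2" by simp
            also have "\<dots> \<le> c1 * log 2 (real n) / \<epsilon>\<^sup>2"
              using c3 elim(2) by (intro divide_right_mono mult_right_mono) auto
            finally have dk: "576 * real k * ln (real n) \<le> real d" using d by linarith
            have kl: "1 \<le> real k * ln (real n)" using mult_mono[of 1 "real k" 1 "ln (real n)"] ln4 k0 by simp
            have d2: "real d \<le> 2 * real (d div 2) + 1" by linarith
            have l4: "ln (4 * real n) \<le> 2 * ln (real n)"
              using elim(2) by (simp add: ln_mult)
            have "72 * real k * ln (4 * real n) \<le> 72 * real k * (2 * ln (real n))"
              using l4 by (intro mult_left_mono) auto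
            with dk kl d2 have D2: "72 * real k * ln (4 * real n) \<le> real (d div 2)" "3 \<le> d div 2"
              by linarith+
            have dd: "(d - d div 2) + d div 2 = d" by simp
            have "1 < 100 * (real ((T + 1) * (s + 1) ^ T) * real ((T + 1) * 2 ^ (w * T))) * (99 / 100) ^ m n"
              by (rule ann_lower_bound_small_eps[where k = k and B = "B n" and h = "d - d div 2" and D = "d div 2" and n = n
                    and t = t and \<epsilon> = \<epsilon> and Dd = D])
                (use elim(1) s w' t \<epsilon> \<epsilon>k D2 k0 n D in \<open>auto simp: B_def m_def dd simp del: of_nat_mult of_nat_power\<close>)
            moreover have "100 * (real ((T + 1) * (s + 1) ^ T) * real ((T + 1) * 2 ^ (w * T))) * (99 / 100) ^ m n \<le> 1"
              using elim(1) s w' unfolding m_def by blast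
            ultimately show False by linarith
          qed
        qed
      qed
    next
      case False
      then have "c3 / \<epsilon>\<^sup>2 < 1" using \<epsilon> by simp
      then have "nat \<lfloor>c3 / \<epsilon>\<^sup>2\<rfloor> \<le> 1" by linarith
      then have k: "k = 1" by (simp add: k_def)
      \<comment> \<open>Here \<open>R = 1 + \<epsilon>\<close> is constant, so a prefix of constant
        length is enough and all other coordinates go to the gadget.\<close>
      define h where "h = nat \<lceil>2 * (1 + \<epsilon>)\<rceil>"
      have h: "2 * (1 + \<epsilon>) \<le> real h" unfolding h_def by linarith
      have C: "0 < 24 / 7 * (2::real) ^ h" "0 < c2 / \<epsilon>\<^sup>2" using assms \<epsilon> by auto
      \<comment> \<open>24/7 is 3/2 divided by 7/16. The saving \<open>n powr (- a)\<close> in the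
        size of \<open>B\<close> pays for the factor polynomial in log n.\<close>
      have ev: "\<forall>\<^sub>F n in sequentially. (24 / 7 * 2 ^ h) * real n powr (- a) * (c2 / \<epsilon>\<^sup>2 * log 2 (real n)) powr (1 + \<epsilon>) \<le> 1"
      proof -
        have "\<forall>\<^sub>F n in sequentially. C * real n powr (- a) * (M * log 2 (real n)) powr R \<le> 1"
          if "0 < M" "0 < C" for R M C :: real
          using that a(1) by real_asymp
        from this[OF C(2,1)] show ?thesis .
      qed
      show ?thesis using params ev eventually_ge_at_top[of "2 ^ h"]
      proof eventually_elim
        case (elim n)
        have n1: "1 \<le> real n" using elim(3) by (metis one_le_numeral one_le_power order.trans real_of_nat_ge_one_iff)
        show ?case
        proof (intro allI impI)
          fix d s w t D
          assume d: "real d \<le> c2 * log 2 (real n) / \<epsilon>\<^sup>2" and n: "2 * n \<le> 2 ^ d" and t: "t \<le> T"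
            and w: "real w \<le> K * real n powr (1 - \<delta>)" and D: "ann_data_structure \<epsilon> n d s w t D"
          show "real s \<ge> real n powr (c / \<epsilon>\<^sup>2)"
          proof (rule ccontr)
            assume "\<not> ?thesis"
            then have s: "real s < real n powr \<kappa>" by (simp add: \<kappa>_def)
            have "real n powr (1 - \<delta>) \<le> real n powr (1 - 4 * a)" using a n1 by (intro powr_mono) auto
            with assms(4) have w': "real w \<le> K * real n powr (1 - 4 * a)"
              by (intro order.trans[OF w] mult_left_mono) auto
            have "0 < n" using n1 by simp
            with elim(3) n have "(2::nat) ^ h < 2 ^ d" by linarith
            then have hd: "h < d" by simp
            define D' where "D' = d - h"
            have D': "0 < D'" "h + D' = d" using hd by (auto simp: D'_def)
            have D'le: "real D' \<le> c2 / \<epsilon>\<^sup>2 * log 2 (real n)" using d by (simp add: D'_def)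
            have "real (2 * n) \<le> real (2 ^ d)" using n by (rule of_nat_mono)
            also have "\<dots> = 2 ^ h * 2 ^ D'" unfolding D'(2)[symmetric] by (simp add: power_add)
            finally have n2: "2 * real n / 2 ^ h \<le> 2 ^ D'" by (simp add: field_simps)
            have Bn: "real (B n) \<le> real n powr (1 - a)" unfolding B_def k by simp
            have "real (B n) * (3 * real D' powr (1 + \<epsilon>) / 2 ^ D')
                \<le> real n powr (1 - a) * (3 * (c2 / \<epsilon>\<^sup>2 * log 2 (real n)) powr (1 + \<epsilon>) / (2 * real n / 2 ^ h))"
              using Bn D'le n2 n1 \<epsilon> D' by (intro mult_mono frac_le mult_left_mono powr_mono2) auto
            also have "\<dots> = 7 / 16 * ((24 / 7 * 2 ^ h) * real n powr (- a) * (c2 / \<epsilon>\<^sup>2 * log 2 (real n)) powr (1 + \<epsilon>))"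
              using n1 by (simp add: powr_diff powr_minus field_simps)
            also have "\<dots> \<le> 7 / 16" using elim(2) by simp
            finally have BD: "real (B n) * (3 * real D' powr (1 + \<epsilon>) / 2 ^ D') \<le> 7 / 16" .
            note par = elim(1)[folded B_def m_def]
            from par s w' have gap: "\<forall>j. k < 10 * j \<longrightarrow>
                200 * real ((T + 1) * (s + 1) ^ T) * real (k * m n) ^ j < real (B n) ^ j"
              and le1: "100 * (real ((T + 1) * (s + 1) ^ T) * real ((T + 1) * 2 ^ (w * T))) * (99 / 100) ^ m n \<le> 1"
              by blast+
            from gap have "200 * real ((T + 1) * (s + 1) ^ T) * real (k * m n) ^ 1 < real (B n) ^ 1"
              using k by (elim allE[of _ 1]) simp
            then have gap1: "200 * real ((T + 1) * (s + 1) ^ T) * real (m n) < real (B n)"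
              unfolding k by (simp only: power_one_right mult_1)
            have "1 < 100 * (real ((T + 1) * (s + 1) ^ T) * real ((T + 1) * 2 ^ (w * T))) * (99 / 100) ^ m n"
              by (rule ann_lower_bound_large_eps[where B = "B n" and h = h and D = D' and n = n
                    and t = t and \<epsilon> = \<epsilon> and Dd = D])
                (use par k t \<epsilon> h n D BD D' gap1 in \<open>auto simp del: of_nat_mult of_nat_power\<close>)
            with le1 show False by linarith
          qed
        qed
      qed
    qed
  qed
qed

end
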